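(* Let $\mathcal{Q}$ be a small quantaloid, $\mathbb{T}=(T,m,e)$ a monad on $\mathbf{Set}$, $\zeta\colon T\mathcal{Q}_0\to\mathcal{Q}_0$ a $\mathbb{T}$-algebra structure on $\mathcal{Q}_0$, and $\xi\colon T\mathsf{P}\mathcal{Q}_0\to\mathsf{P}\mathcal{Q}_0$ a topological theory for $\mathbb{T}$ and $\mathcal{Q}$. Then $$\lambda_X^{\xi}:=(\zeta\cdot Ta)^!\cdot\xi\cdot T(a_!)\colon T\mathsf{P}X\to\mathsf{P}TX,$$ for all $X=(X,a)\in\mathbf{Set}/\mathcal{Q}_0$, defines a monotone distributive law $\lambda^{\xi}$ of $\mathbb{T}$ over $\mathbb{P}_{\mathcal{Q}}$. This law is the largest (with respect to the componentwise, pointwise order) amongst all monotone distributive laws $\kappa$ that induce the given theory $\xi$, i.e. that satisfy $\zeta_!\cdot\kappa_{\mathcal{Q}_0}=\xi$ (and $\lambda^\xi$ itself induces $\xi$).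
   Context: A quantaloid is a category whose hom-sets are complete lattices and whose composition preserves arbitrary suprema in each variable. $\mathcal{Q}$ is a small quantaloid with object set $\mathcal{Q}_0$; $\bot$ denotes bottom elements of hom-sets. Objects of $\mathbf{Set}/\mathcal{Q}_0$ are sets $X$ with an array map $a=|\cdot|_X\colon X\to\mathcal{Q}_0$; morphisms are array-preserving maps. The set $\mathcal{Q}_0$ has array map $1_{\mathcal{Q}_0}$, so that $a$ is itself a morphism $(X,a)\to(\mathcal{Q}_0,1)$. Discrete presheaf monad $\mathbb{P}_{\mathcal{Q}}=(\mathsf{P},\mathsf{s},\mathsf{y})$ on $\mathbf{Set}/\mathcal{Q}_0$: $\mathsf{P}X$ is the set of all families $\sigma=(\sigma_x\colon|x|\to s)_{x\in X}$ of $\mathcal{Q}$-morphisms with a specified common codomain $s=:|\sigma|\in\mathcal{Q}_0$ (this gives the array map of $\mathsf{P}X$), ordered by $\sigma\le\sigma'$ iff $|\sigma|=|\sigma'|$ and $\sigma_x\le\sigma'_x$ for all $x$. Maps into $\mathsf{P}X$ are ordered pointwise. For $f\colon X\to Y$ in $\mathbf{Set}/\mathcal{Q}_0$: $\mathsf{P}f=f_!\colon\mathsf{P}X\to\mathsf{P}Y$, $(f_!\sigma)_y=\bigvee_{x\in f^{-1}y}\sigma_x$ (arrays preserved); its right adjoint is $f^!\colon\mathsf{P}Y\to\mathsf{P}X$, $(f^!\tau)_x=\tau_{fx}$. Further, $\mathsf{y}_X\colon X\to\mathsf{P}X$, $(\mathsf{y}_Xy)_x=1_{|y|}$ if $x=y$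 and $\bot$ otherwise; $\mathsf{s}_X\colon\mathsf{P}\mathsf{P}X\to\mathsf{P}X$, $(\mathsf{s}_X\Sigma)_x=\bigvee_{\sigma\in\mathsf{P}X}\Sigma_\sigma\circ\sigma_x$. Given $\mathbb{T}$ and $\zeta$ (an Eilenberg–Moore algebra structure), $\mathbb{T}$ is regarded as a monad on $\mathbf{Set}/\mathcal{Q}_0$ by giving $TX$ the array map $\zeta\cdot Ta$ whenever $X$ has array map $a$. A monotone distributive law of $\mathbb{T}$ over $\mathbb{P}_{\mathcal{Q}}$ is a family of morphisms $\lambda_X\colon T\mathsf{P}X\to\mathsf{P}TX$ in $\mathbf{Set}/\mathcal{Q}_0$ such that for all $X$ and $f\colon X\to Y$: (a) $(Tf)_!\cdot\lambda_X\le\lambda_Y\cdot T(f_!)$; (b) $\mathsf{y}_{TX}\le\lambda_X\cdot T\mathsf{y}_X$; (c) $\mathsf{s}_{TX}\cdot(\lambda_X)_!\cdot\lambda_{\mathsf{P}X}\le\lambda_X\cdot T\mathsf{s}_X$; (d) $(e_X)_!\le\lambda_X\cdot e_{\mathsf{P}X}$; (e) $(m_X)_!\cdot\lambda_{TX}\cdot T\lambda_X\le\lambda_X\cdot m_{\mathsf{P}X}$; and (monotonicity) $f\le g\Rightarrow\lambda_X\cdot Tf\le\lambda_X\cdot Tg$ for all $f,g\colon Y\to\mathsf{P}X$ in $\mathbf{Set}/\mathcal{Q}_0$. Topological theory: let $t\colon\mathsf{P}\mathcal{Q}_0\to\mathcal{Q}_0$ be the array map of $\mathsf{P}\mathcal{Q}_0$.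 A topological theory for $\mathbb{T}$ and $\mathcal{Q}$ (with respect to $\zeta$) is a map $\xi\colon T\mathsf{P}\mathcal{Q}_0\to\mathsf{P}\mathcal{Q}_0$ such that: (0) $t\cdot\xi=\zeta\cdot Tt$; (1) $1_{\mathsf{P}\mathcal{Q}_0}\le\xi\cdot e_{\mathsf{P}\mathcal{Q}_0}$ and $\xi\cdot T\xi\le\xi\cdot m_{\mathsf{P}\mathcal{Q}_0}$; (2) $\mathsf{y}_{\mathcal{Q}_0}\cdot\zeta\le\xi\cdot T\mathsf{y}_{\mathcal{Q}_0}$ and $\mathsf{s}_{\mathcal{Q}_0}\cdot\theta\le\xi\cdot T\mathsf{s}_{\mathcal{Q}_0}$, where $\theta:=\xi_!\cdot(\zeta\cdot Tt)^!\cdot\xi\cdot T(t_!)\colon T\mathsf{P}\mathsf{P}\mathcal{Q}_0\to\mathsf{P}\mathsf{P}\mathcal{Q}_0$; (3) for all $f,g\colon Y\to\mathsf{P}\mathcal{Q}_0$ in $\mathbf{Set}/\mathcal{Q}_0$, $f\le g$ implies $\xi\cdot Tf\le\xi\cdot Tg$. *)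

theory Defs
  imports "HOL-Algebra.Complete_Lattice" "HOL-Library.FuncSet" "HOL-Library.Nat_Bijection"
begin

section \<open>A universe of sets\<close>

text \<open>
  The category \<open>Set\<close> has to contain \<open>X\<close>, \<open>PX\<close>, \<open>TPX\<close>, \<open>PPTX\<close>, ... side by side as values of one
  functor, so all its objects are sets over one type, the points of a universe. The objects of
  \<open>Set\<close> are the \<open>small\<close> sets of points; every small set is itself represented by a point, and
  the closure properties are those of a Grothendieck universe. Neither well-foundedness nor an
  infinite small set is assumed. (HOL proves the existence of hereditarily finite universes only;
  the universe of a model of ZFC is an instance as well.)
\<close>

class set_universe =
  fixes small :: "'a set \<Rightarrow> bool"
    and code :: "'a set \<Rightarrow> 'a"
  assumes small_pair: "small {x, y}"
    and small_subset: "small A \<Longrightarrow> B \<subseteq> A \<Longrightarrow> small B"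
    and small_UN: "small A \<Longrightarrow> (\<And>x. x \<in> A \<Longrightarrow> small (F x)) \<Longrightarrow> small (\<Union>x\<in>A. F x)"
    and small_Pow: "small A \<Longrightarrow> small (code ` Pow A)"
    and inj_code: "inj_on code (Collect small)"

instantiation nat :: set_universe
begin

definition small_nat :: "nat set \<Rightarrow> bool" where "small_nat = finite"
definition code_nat :: "nat set \<Rightarrow> nat" where "code_nat = set_encode"

instance
  by standard (auto simp: small_nat_def code_nat_def finite_subset inj_on_set_encode)

end

definition elts :: "'u::set_universe \<Rightarrow> 'u set" where
  "elts = the_inv_into (Collect small) code"

definition pair :: "'u::set_universe \<Rightarrow> 'u \<Rightarrow> 'u" where
  "pair x y = code {code {x}, code {x, y}}"

definition pfst :: "'u::set_universe \<Rightarrow> 'u" where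
  "pfst p = (THE x. \<exists>y. p = pair x y)"

definition psnd :: "'u::set_universe \<Rightarrow> 'u" where
  "psnd p = (THE y. \<exists>x. p = pair x y)"

definition graph :: "'u::set_universe set \<Rightarrow> ('u \<Rightarrow> 'u) \<Rightarrow> 'u" where
  "graph X f = code ((\<lambda>x. pair x (f x)) ` X)"

definition app :: "'u::set_universe \<Rightarrow> 'u \<Rightarrow> 'u" where
  "app g x = (THE y. pair x y \<in> elts g)"


section \<open>Small quantaloids\<close>

text \<open>\<open>Comp Q r s t g f\<close> is the composite \<open>g \<circ> f\<close> of \<open>f: r \<rightarrow> s\<close> and \<open>g: s \<rightarrow> t\<close>. Hom-sets need not be
  disjoint, hence the indices.\<close>

record 'u quantaloid =
  Ob :: "'u set"
  Hom :: "'u \<Rightarrow> 'u \<Rightarrow> 'u gorder"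
  Comp :: "'u \<Rightarrow> 'u \<Rightarrow> 'u \<Rightarrow> 'u \<Rightarrow> 'u \<Rightarrow> 'u"
  Idn :: "'u \<Rightarrow> 'u"

locale small_quantaloid =
  fixes Q :: "'u::set_universe quantaloid"
  assumes small_Ob: "small (Ob Q)"
    and small_Hom: "\<lbrakk>r \<in> Ob Q; s \<in> Ob Q\<rbrakk> \<Longrightarrow> small (carrier (Hom Q r s))"
    and Hom_complete: "\<lbrakk>r \<in> Ob Q; s \<in> Ob Q\<rbrakk> \<Longrightarrow> complete_lattice (Hom Q r s)"
    and Idn_closed: "r \<in> Ob Q \<Longrightarrow> Idn Q r \<in> carrier (Hom Q r r)"
    and Comp_closed: "\<lbrakk>r \<in> Ob Q; s \<in> Ob Q; t \<in> Ob Q;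
        f \<in> carrier (Hom Q r s); g \<in> carrier (Hom Q s t)\<rbrakk>
      \<Longrightarrow> Comp Q r s t g f \<in> carrier (Hom Q r t)"
    and Comp_Idn_left: "\<lbrakk>r \<in> Ob Q; s \<in> Ob Q; f \<in> carrier (Hom Q r s)\<rbrakk>
      \<Longrightarrow> Comp Q r s s (Idn Q s) f = f"
    and Comp_Idn_right: "\<lbrakk>r \<in> Ob Q; s \<in> Ob Q; f \<in> carrier (Hom Q r s)\<rbrakk>
      \<Longrightarrow> Comp Q r r s f (Idn Q r) = f"
    and Comp_assoc: "\<lbrakk>r \<in> Ob Q; s \<in> Ob Q; t \<in> Ob Q; u \<in> Ob Q;
        f \<in> carrier (Hom Q r s); g \<in> carrier (Hom Q s t); h \<in> carrier (Hom Q t u)\<rbrakk>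
      \<Longrightarrow> Comp Q r t u h (Comp Q r s t g f) = Comp Q r s u (Comp Q s t u h g) f"
    and Comp_sup_right: "\<lbrakk>r \<in> Ob Q; s \<in> Ob Q; t \<in> Ob Q; g \<in> carrier (Hom Q s t)\<rbrakk>
      \<Longrightarrow> sup_pres (Hom Q r s) (Hom Q r t) (\<lambda>f. Comp Q r s t g f)"
    and Comp_sup_left: "\<lbrakk>r \<in> Ob Q; s \<in> Ob Q; t \<in> Ob Q; f \<in> carrier (Hom Q r s)\<rbrakk>
      \<Longrightarrow> sup_pres (Hom Q s t) (Hom Q r t) (\<lambda>g. Comp Q r s t g f)"


section \<open>Monads on Set and their algebras\<close>

text \<open>
  Morphisms \<open>X \<rightarrow> Y\<close> of \<open>Set\<close> are the elements of \<open>X \<rightarrow>\<^sub>E Y\<close>, and their composition is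
  \<open>compose X g f\<close>. As the action of a functor on a map may depend on the chosen codomain,
  \<open>Tmap M X Y f\<close> carries domain and codomain: it is \<open>Tf: TX \<rightarrow> TY\<close> for \<open>f: X \<rightarrow> Y\<close>.
\<close>

record 'u set_monad =
  Tob :: "'u set \<Rightarrow> 'u set"
  Tmap :: "'u set \<Rightarrow> 'u set \<Rightarrow> ('u \<Rightarrow> 'u) \<Rightarrow> ('u \<Rightarrow> 'u)"
  mul :: "'u set \<Rightarrow> ('u \<Rightarrow> 'u)"
  ret :: "'u set \<Rightarrow> ('u \<Rightarrow> 'u)"

locale monad_on_Set =
  fixes M :: "'u::set_universe set_monad"
  assumes Tob_small: "small X \<Longrightarrow> small (Tob M X)"
    and Tmap_closed: "\<lbrakk>small X; small Y; f \<in> X \<rightarrow>\<^sub>E Y\<rbrakk> \<Longrightarrow> Tmap M X Y f \<in> Tob M X \<rightarrow>\<^sub>E Tob M Y"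
    and Tmap_id: "small X \<Longrightarrow> Tmap M X X (\<lambda>x\<in>X. x) = (\<lambda>x\<in>Tob M X. x)"
    and Tmap_compose: "\<lbrakk>small X; small Y; small Z; f \<in> X \<rightarrow>\<^sub>E Y; g \<in> Y \<rightarrow>\<^sub>E Z\<rbrakk>
      \<Longrightarrow> Tmap M X Z (compose X g f) = compose (Tob M X) (Tmap M Y Z g) (Tmap M X Y f)"
    and mul_closed: "small X \<Longrightarrow> mul M X \<in> Tob M (Tob M X) \<rightarrow>\<^sub>E Tob M X"
    and ret_closed: "small X \<Longrightarrow> ret M X \<in> X \<rightarrow>\<^sub>E Tob M X"
    and mul_natural: "\<lbrakk>small X; small Y; f \<in> X \<rightarrow>\<^sub>E Y\<rbrakk>
      \<Longrightarrow> compose (Tob M (Tob M X)) (Tmap M X Y f) (mul M X)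
        = compose (Tob M (Tob M X)) (mul M Y) (Tmap M (Tob M X) (Tob M Y) (Tmap M X Y f))"
    and ret_natural: "\<lbrakk>small X; small Y; f \<in> X \<rightarrow>\<^sub>E Y\<rbrakk>
      \<Longrightarrow> compose X (Tmap M X Y f) (ret M X) = compose X (ret M Y) f"
    and mul_ret: "small X \<Longrightarrow> compose (Tob M X) (mul M X) (ret M (Tob M X)) = (\<lambda>x\<in>Tob M X. x)"
    and mul_Tret: "small X
      \<Longrightarrow> compose (Tob M X) (mul M X) (Tmap M X (Tob M X) (ret M X)) = (\<lambda>x\<in>Tob M X. x)"
    and mul_mul: "small X
      \<Longrightarrow> compose (Tob M (Tob M (Tob M X))) (mul M X) (mul M (Tob M X))
        = compose (Tob M (Tob M (Tob M X))) (mul M X) (Tmap M (Tob M (Tob M X)) (Tob M X) (mul M X))"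

definition em_algebra :: "'u::set_universe set_monad \<Rightarrow> 'u set \<Rightarrow> ('u \<Rightarrow> 'u) \<Rightarrow> bool" where
  "em_algebra M A \<zeta> \<longleftrightarrow>
     small A \<and> \<zeta> \<in> Tob M A \<rightarrow>\<^sub>E A \<and>
     compose A \<zeta> (ret M A) = (\<lambda>x\<in>A. x) \<and>
     compose (Tob M (Tob M A)) \<zeta> (mul M A) = compose (Tob M (Tob M A)) \<zeta> (Tmap M (Tob M A) A \<zeta>)"


section \<open>The slice category over the objects of a quantaloid\<close>

record 'u slice =
  pts :: "'u set"
  arr :: "'u \<Rightarrow> 'u"

definition slice_ob :: "'u::set_universe quantaloid \<Rightarrow> 'u slice \<Rightarrow> bool" where
  "slice_ob Q X \<longleftrightarrow> small (pts X) \<and> arr X \<in> pts X \<rightarrow>\<^sub>E Ob Q"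

definition slice_hom :: "'u slice \<Rightarrow> 'u slice \<Rightarrow> ('u \<Rightarrow> 'u) set" where
  "slice_hom X Y = {f \<in> pts X \<rightarrow>\<^sub>E pts Y. \<forall>x\<in>pts X. arr Y (f x) = arr X x}"

definition base :: "'u quantaloid \<Rightarrow> 'u slice" where
  "base Q = \<lparr>pts = Ob Q, arr = (\<lambda>q\<in>Ob Q. q)\<rparr>"

text \<open>The extension of a monad on \<open>Set\<close> to the slice category, \<open>TX\<close> having the array map \<open>\<zeta> \<cdot> Ta\<close>.\<close>

definition T_ob ::
  "'u quantaloid \<Rightarrow> 'u set_monad \<Rightarrow> ('u \<Rightarrow> 'u) \<Rightarrow> 'u slice \<Rightarrow> 'u slice" where
  "T_ob Q M \<zeta> X =
     \<lparr>pts = Tob M (pts X), arr = compose (Tob M (pts X)) \<zeta> (Tmap M (pts X) (Ob Q) (arr X))\<rparr>"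

definition T_map ::
  "'u set_monad \<Rightarrow> 'u slice \<Rightarrow> 'u slice \<Rightarrow> ('u \<Rightarrow> 'u) \<Rightarrow> ('u \<Rightarrow> 'u)" where
  "T_map M X Y f = Tmap M (pts X) (pts Y) f"


section \<open>The discrete presheaf monad\<close>

text \<open>A family \<open>(\<sigma> x: |x| \<rightarrow> s)\<close> over \<open>x \<in> X\<close> is encoded as the pair of its codomain \<open>s\<close> and the
  graph of \<open>\<sigma>\<close>.\<close>

definition fam :: "'u::set_universe slice \<Rightarrow> 'u \<Rightarrow> ('u \<Rightarrow> 'u) \<Rightarrow> 'u" where
  "fam X s \<sigma> = pair s (graph (pts X) \<sigma>)"

definition fcod :: "'u::set_universe \<Rightarrow> 'u" where
  "fcod p = pfst p"

definition fcomp :: "'u::set_universe \<Rightarrow> 'u \<Rightarrow> 'u" where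
  "fcomp p x = app (psnd p) x"

definition psh_set :: "'u::set_universe quantaloid \<Rightarrow> 'u slice \<Rightarrow> 'u set" where
  "psh_set Q X =
     {fam X s \<sigma> | s \<sigma>. s \<in> Ob Q \<and> (\<forall>x\<in>pts X. \<sigma> x \<in> carrier (Hom Q (arr X x) s))}"

definition P_ob :: "'u::set_universe quantaloid \<Rightarrow> 'u slice \<Rightarrow> 'u slice" where
  "P_ob Q X = \<lparr>pts = psh_set Q X, arr = (\<lambda>p\<in>psh_set Q X. fcod p)\<rparr>"

definition psh_le :: "'u::set_universe quantaloid \<Rightarrow> 'u slice \<Rightarrow> 'u \<Rightarrow> 'u \<Rightarrow> bool" where
  "psh_le Q X p q \<longleftrightarrow>
     fcod p = fcod q \<and>
     (\<forall>x\<in>pts X. fcomp p x \<sqsubseteq>\<^bsub>Hom Q (arr X x) (fcod p)\<^esub> fcomp q x)"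

definition ptwise_le ::
  "'u::set_universe quantaloid \<Rightarrow> 'u set \<Rightarrow> 'u slice \<Rightarrow> ('u \<Rightarrow> 'u) \<Rightarrow> ('u \<Rightarrow> 'u) \<Rightarrow> bool" where
  "ptwise_le Q A X f g \<longleftrightarrow> (\<forall>a\<in>A. psh_le Q X (f a) (g a))"

text \<open>\<open>push\<close> is \<open>f\<^sub>! = Pf: PX \<rightarrow> PY\<close>, and \<open>pull\<close> is its right adjoint \<open>PY \<rightarrow> PX\<close>.\<close>

definition push ::
  "'u::set_universe quantaloid \<Rightarrow> 'u slice \<Rightarrow> 'u slice \<Rightarrow> ('u \<Rightarrow> 'u) \<Rightarrow> ('u \<Rightarrow> 'u)" where
  "push Q X Y f = (\<lambda>p\<in>psh_set Q X. fam Y (fcod p)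
     (\<lambda>y. \<Squnion>\<^bsub>Hom Q (arr Y y) (fcod p)\<^esub> {fcomp p x | x. x \<in> pts X \<and> f x = y}))"

definition pull ::
  "'u::set_universe quantaloid \<Rightarrow> 'u slice \<Rightarrow> 'u slice \<Rightarrow> ('u \<Rightarrow> 'u) \<Rightarrow> ('u \<Rightarrow> 'u)" where
  "pull Q X Y f = (\<lambda>q\<in>psh_set Q Y. fam X (fcod q) (\<lambda>x. fcomp q (f x)))"

definition yon :: "'u::set_universe quantaloid \<Rightarrow> 'u slice \<Rightarrow> ('u \<Rightarrow> 'u)" where
  "yon Q X = (\<lambda>y\<in>pts X. fam X (arr X y)
     (\<lambda>x. if x = y then Idn Q (arr X y) else \<bottom>\<^bsub>Hom Q (arr X x) (arr X y)\<^esub>))"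

definition psup :: "'u::set_universe quantaloid \<Rightarrow> 'u slice \<Rightarrow> ('u \<Rightarrow> 'u)" where
  "psup Q X = (\<lambda>S\<in>psh_set Q (P_ob Q X). fam X (fcod S)
     (\<lambda>x. \<Squnion>\<^bsub>Hom Q (arr X x) (fcod S)\<^esub>
        {Comp Q (arr X x) (fcod p) (fcod S) (fcomp S p) (fcomp p x) | p. p \<in> psh_set Q X}))"


section \<open>Monotone distributive laws\<close>

definition monotone_distributive_law ::
  "'u::set_universe quantaloid \<Rightarrow> 'u set_monad \<Rightarrow> ('u \<Rightarrow> 'u) \<Rightarrow> ('u slice \<Rightarrow> 'u \<Rightarrow> 'u) \<Rightarrow> bool" where
  "monotone_distributive_law Q M \<zeta> \<kappa> \<longleftrightarrow>
    (let T = T_ob Q M \<zeta>; P = P_ob Q in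
     (\<forall>X. slice_ob Q X \<longrightarrow> \<kappa> X \<in> slice_hom (T (P X)) (P (T X))) \<and>
     (\<forall>X Y f. slice_ob Q X \<and> slice_ob Q Y \<and> f \<in> slice_hom X Y \<longrightarrow>
        ptwise_le Q (pts (T (P X))) (T Y)
          (compose (pts (T (P X))) (push Q (T X) (T Y) (T_map M X Y f)) (\<kappa> X))
          (compose (pts (T (P X))) (\<kappa> Y) (T_map M (P X) (P Y) (push Q X Y f)))) \<and>
     (\<forall>X. slice_ob Q X \<longrightarrow>
        ptwise_le Q (pts (T X)) (T X)
          (yon Q (T X))
          (compose (pts (T X)) (\<kappa> X) (T_map M X (P X) (yon Q X)))) \<and>
     (\<forall>X. slice_ob Q X \<longrightarrow>
        ptwise_le Q (pts (T (P (P X)))) (T X)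
          (compose (pts (T (P (P X)))) (psup Q (T X))
            (compose (pts (T (P (P X)))) (push Q (T (P X)) (P (T X)) (\<kappa> X)) (\<kappa> (P X))))
          (compose (pts (T (P (P X)))) (\<kappa> X) (T_map M (P (P X)) (P X) (psup Q X)))) \<and>
     (\<forall>X. slice_ob Q X \<longrightarrow>
        ptwise_le Q (pts (P X)) (T X)
          (push Q X (T X) (ret M (pts X)))
          (compose (pts (P X)) (\<kappa> X) (ret M (pts (P X))))) \<and>
     (\<forall>X. slice_ob Q X \<longrightarrow>
        ptwise_le Q (pts (T (T (P X)))) (T X)
          (compose (pts (T (T (P X)))) (push Q (T (T X)) (T X) (mul M (pts X)))
            (compose (pts (T (T (P X)))) (\<kappa> (T X)) (T_map M (T (P X)) (P (T X)) (\<kappa> X))))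
          (compose (pts (T (T (P X)))) (\<kappa> X) (mul M (pts (P X))))) \<and>
     (\<forall>X Y f g. slice_ob Q X \<and> slice_ob Q Y \<and> f \<in> slice_hom Y (P X) \<and> g \<in> slice_hom Y (P X) \<and>
          ptwise_le Q (pts Y) X f g \<longrightarrow>
        ptwise_le Q (pts (T Y)) (T X)
          (compose (pts (T Y)) (\<kappa> X) (T_map M Y (P X) f))
          (compose (pts (T Y)) (\<kappa> X) (T_map M Y (P X) g))))"


section \<open>Topological theories\<close>

text \<open>The map \<open>\<theta> = \<xi>\<^sub>! \<cdot> (\<zeta> \<cdot> Tt)\<^sup>! \<cdot> \<xi> \<cdot> T(t\<^sub>!)\<close>, where \<open>t\<close> is the array map of \<open>PQ\<^sub>0\<close>, so that \<open>\<zeta> \<cdot> Tt\<close>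
  is the array map of \<open>TPQ\<^sub>0\<close>.\<close>

definition theta ::
  "'u::set_universe quantaloid \<Rightarrow> 'u set_monad \<Rightarrow> ('u \<Rightarrow> 'u) \<Rightarrow> ('u \<Rightarrow> 'u) \<Rightarrow> ('u \<Rightarrow> 'u)" where
  "theta Q M \<zeta> \<xi> =
    (let B = base Q; T = T_ob Q M \<zeta>; P = P_ob Q; D = pts (T (P (P B))); t = arr (P B) in
      compose D (push Q (T (P B)) (P B) \<xi>)
        (compose D (pull Q (T (P B)) B (arr (T (P B))))
          (compose D \<xi> (T_map M (P (P B)) (P B) (push Q (P B) B t)))))"

definition topological_theory ::
  "'u::set_universe quantaloid \<Rightarrow> 'u set_monad \<Rightarrow> ('u \<Rightarrow> 'u) \<Rightarrow> ('u \<Rightarrow> 'u) \<Rightarrow> bool" where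
  "topological_theory Q M \<zeta> \<xi> \<longleftrightarrow>
    (let B = base Q; T = T_ob Q M \<zeta>; P = P_ob Q; t = arr (P B) in
     \<xi> \<in> pts (T (P B)) \<rightarrow>\<^sub>E pts (P B) \<and>
     compose (pts (T (P B))) t \<xi> = compose (pts (T (P B))) \<zeta> (Tmap M (pts (P B)) (Ob Q) t) \<and>
     ptwise_le Q (pts (P B)) B
       (\<lambda>p\<in>pts (P B). p)
       (compose (pts (P B)) \<xi> (ret M (pts (P B)))) \<and>
     ptwise_le Q (pts (T (T (P B)))) B
       (compose (pts (T (T (P B)))) \<xi> (T_map M (T (P B)) (P B) \<xi>))
       (compose (pts (T (T (P B)))) \<xi> (mul M (pts (P B)))) \<and>
     ptwise_le Q (pts (T B)) B
       (compose (pts (T B)) (yon Q B) \<zeta>)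
       (compose (pts (T B)) \<xi> (T_map M B (P B) (yon Q B))) \<and>
     ptwise_le Q (pts (T (P (P B)))) B
       (compose (pts (T (P (P B)))) (psup Q B) (theta Q M \<zeta> \<xi>))
       (compose (pts (T (P (P B)))) \<xi> (T_map M (P (P B)) (P B) (psup Q B))) \<and>
     (\<forall>Y f g. slice_ob Q Y \<and> f \<in> slice_hom Y (P B) \<and> g \<in> slice_hom Y (P B) \<and>
          ptwise_le Q (pts Y) B f g \<longrightarrow>
        ptwise_le Q (pts (T Y)) B
          (compose (pts (T Y)) \<xi> (T_map M Y (P B) f))
          (compose (pts (T Y)) \<xi> (T_map M Y (P B) g))))"

text \<open>The law \<open>\<lambda>\<^sup>\<xi>\<close>, with components \<open>(\<zeta> \<cdot> Ta)\<^sup>! \<cdot> \<xi> \<cdot> T(a\<^sub>!)\<close>.\<close>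

definition law_of_theory ::
  "'u::set_universe quantaloid \<Rightarrow> 'u set_monad \<Rightarrow> ('u \<Rightarrow> 'u) \<Rightarrow> ('u \<Rightarrow> 'u) \<Rightarrow> 'u slice \<Rightarrow> ('u \<Rightarrow> 'u)" where
  "law_of_theory Q M \<zeta> \<xi> X =
    (let B = base Q; T = T_ob Q M \<zeta>; P = P_ob Q; D = pts (T (P X)) in
      compose D (pull Q (T X) B (arr (T X)))
        (compose D \<xi> (T_map M (P X) (P B) (push Q X B (arr X)))))"

definition induces ::
  "'u::set_universe quantaloid \<Rightarrow> 'u set_monad \<Rightarrow> ('u \<Rightarrow> 'u) \<Rightarrow> ('u slice \<Rightarrow> 'u \<Rightarrow> 'u) \<Rightarrow> ('u \<Rightarrow> 'u) \<Rightarrow> bool" where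
  "induces Q M \<zeta> \<kappa> \<xi> \<longleftrightarrow>
    (let B = base Q; T = T_ob Q M \<zeta>; P = P_ob Q in
      compose (pts (T (P B))) (push Q (T B) B \<zeta>) (\<kappa> B) = \<xi>)"


section \<open>Soundness of the encodings\<close>

lemma small_image: "small A \<Longrightarrow> small (f ` A)" for f :: "'u::set_universe \<Rightarrow> 'u"
  using small_UN[of A "\<lambda>x. {f x}"] small_pair[of "f x" "f x" for x] by (simp add: UNION_singleton_eq_range)

lemma elts_code: "small A \<Longrightarrow> elts (code A) = A"
  unfolding elts_def by (rule the_inv_into_f_f[OF inj_code]) simp

lemma small_singleton: "small {x::'u::set_universe}"
  using small_pair[of x x] by simp

lemma code_eq_iff: "small A \<Longrightarrow> small B \<Longrightarrow> code A = code B \<longleftrightarrow> A = B"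
  by (metis elts_code)

lemma pair_eq_iff [simp]: "pair x y = pair x' y' \<longleftrightarrow> x = x' \<and> y = y'"
  unfolding pair_def
  by (auto simp: code_eq_iff small_pair small_singleton doubleton_eq_iff)

lemma pfst_pair [simp]: "pfst (pair x y) = x"
  and psnd_pair [simp]: "psnd (pair x y) = y"
  by (simp_all add: pfst_def psnd_def)

lemma app_graph: "small X \<Longrightarrow> x \<in> X \<Longrightarrow> app (graph X f) x = f x"
  by (auto simp: app_def graph_def elts_code small_image)

lemma fcod_fam [simp]: "fcod (fam X s \<sigma>) = s"
  by (simp add: fcod_def fam_def)

lemma fcomp_fam: "small (pts X) \<Longrightarrow> x \<in> pts X \<Longrightarrow> fcomp (fam X s \<sigma>) x = \<sigma> x"
  by (simp add: fcomp_def fam_def app_graph)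

lemma small_UN_pair: "small A \<Longrightarrow> (\<And>a. a \<in> A \<Longrightarrow> small (F a)) \<Longrightarrow> small (\<Union>a\<in>A. pair a ` F a)"
  for A :: "'u::set_universe set"
  by (rule small_UN) (auto intro: small_image)

lemma (in small_quantaloid) slice_ob_P:
  assumes "slice_ob Q X"
  shows "slice_ob Q (P_ob Q X)"
proof -
  have sX: "small (pts X)" and aX: "\<And>x. x \<in> pts X \<Longrightarrow> arr X x \<in> Ob Q"
    using assms by (auto simp: slice_ob_def)
  let ?G = "\<lambda>s. \<Union>x\<in>pts X. pair x ` carrier (Hom Q (arr X x) s)"
  have "small (\<Union>s\<in>Ob Q. pair s ` (code ` Pow (?G s)))"
    by (intro small_UN_pair small_Ob small_Pow sX small_Hom aX)
  moreover have "psh_set Q X \<subseteq> (\<Union>s\<in>Ob Q. pair s ` (code ` Pow (?G s)))"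
  proof
    fix p assume "p \<in> psh_set Q X"
    then obtain s \<sigma> where p: "p = fam X s \<sigma>" and s: "s \<in> Ob Q"
      and \<sigma>: "\<forall>x\<in>pts X. \<sigma> x \<in> carrier (Hom Q (arr X x) s)"
      by (auto simp: psh_set_def)
    have "(\<lambda>x. pair x (\<sigma> x)) ` pts X \<in> Pow (?G s)"
      using \<sigma> by blast
    then show "p \<in> (\<Union>s\<in>Ob Q. pair s ` (code ` Pow (?G s)))"
      using s unfolding p fam_def graph_def by blast
  qed
  ultimately have "small (psh_set Q X)"
    by (rule small_subset)
  then show ?thesis
    by (auto simp: slice_ob_def P_ob_def psh_set_def)
qed

lemma slice_ob_base: "small_quantaloid Q \<Longrightarrow> slice_ob Q (base Q)"
  by (auto simp: slice_ob_def base_def small_quantaloid_def)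

lemma slice_ob_T:
  assumes "monad_on_Set M" "em_algebra M (Ob Q) \<zeta>" "slice_ob Q X"
  shows "slice_ob Q (T_ob Q M \<zeta> X)"
proof -
  interpret monad_on_Set M by fact
  have "Tmap M (pts X) (Ob Q) (arr X) \<in> Tob M (pts X) \<rightarrow>\<^sub>E Tob M (Ob Q)"
    using assms by (intro Tmap_closed) (auto simp: slice_ob_def em_algebra_def)
  then show ?thesis
    using assms by (auto simp: slice_ob_def em_algebra_def T_ob_def compose_def Tob_small)
qed

end

theory Submission
  imports Defs
begin

text \<open>
  Write \<open>\<alpha> = \<zeta> \<cdot> Ta\<close> for the array map of \<open>TX\<close> and \<open>c\<^sub>X = \<xi> \<cdot> T(a\<^sub>!)\<close> (\<open>theory_at X\<close> below), so that
  the law is \<open>\<alpha>\<^sup>! \<cdot> c\<^sub>X\<close>. Everything rests on the adjunction \<open>f\<^sub>! \<stileturn> f\<^sup>!\<close>: an inequality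
  \<open>p \<le> \<lambda>\<^sub>X w\<close> over \<open>TX\<close> is the same as \<open>\<alpha>\<^sub>! p \<le> c\<^sub>X w\<close> over the objects of the quantaloid
  (\<open>le_law_iff\<close>), and over the objects the axioms of the theory apply. As \<open>c\<^sub>X\<close> is natural in \<open>X\<close>
  and every map that occurs preserves arrays, each axiom of a distributive law becomes the
  corresponding axiom of \<open>\<xi>\<close>: the unit axioms by naturality of \<open>y\<close> and of the unit of the monad,
  the multiplication axiom by \<open>\<alpha>\<^sub>! \<cdot> \<alpha>\<^sup>! \<le> 1\<close> and monotonicity of \<open>\<xi>\<close>, naturality and monotonicity
  at once.

  Only the axiom for the presheaf multiplication \<open>s\<close> (\<open>law_psup\<close>) needs more. By
  \<open>psup_push_le_iff\<close>, \<open>s \<cdot> f\<^sub>!\<close> is a supremum of composites indexed by the domain of \<open>f\<close>. For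
  \<open>f = \<lambda>\<^sub>X\<close> the index set is \<open>TPX\<close>, for \<open>f = \<xi>\<close>, which occurs in the axiom for \<open>\<xi>\<close>, it is the
  value of \<open>TP\<close> at the set of objects; \<open>T(a\<^sub>!)\<close> maps the former to the latter and preserves the
  composites.

  The law induces \<open>\<xi>\<close> because \<open>\<zeta>\<close> is surjective, hence \<open>\<zeta>\<^sub>! \<cdot> \<zeta>\<^sup>! = 1\<close>. It is the largest such law
  because for any other one, \<open>\<kappa>\<close>, naturality along the array map \<open>a\<close> and \<open>\<alpha> = \<zeta> \<cdot> Ta\<close> give
  \<open>\<alpha>\<^sub>! \<cdot> \<kappa>\<^sub>X \<le> \<zeta>\<^sub>! \<cdot> \<kappa> \<cdot> T(a\<^sub>!) = c\<^sub>X\<close>, which is \<open>\<kappa>\<^sub>X \<le> \<alpha>\<^sup>! \<cdot> c\<^sub>X\<close>.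
\<close>

section \<open>Suprema in complete lattices\<close>

lemma complete_lattice_sup_le_iff:
  assumes "complete_lattice L" "A \<subseteq> carrier L" "z \<in> carrier L"
  shows "\<Squnion>\<^bsub>L\<^esub> A \<sqsubseteq>\<^bsub>L\<^esub> z \<longleftrightarrow> (\<forall>a\<in>A. a \<sqsubseteq>\<^bsub>L\<^esub> z)"
proof -
  interpret complete_lattice L by fact
  show ?thesis
    using assms(2,3) by (meson le_trans subsetD sup_closed sup_least sup_upper)
qed

lemma complete_lattice_sup_closed:
  "complete_lattice L \<Longrightarrow> A \<subseteq> carrier L \<Longrightarrow> \<Squnion>\<^bsub>L\<^esub> A \<in> carrier L"
proof -
  assume "complete_lattice L" "A \<subseteq> carrier L"
  then interpret complete_lattice L by simp
  show ?thesis using \<open>A \<subseteq> carrier L\<close> by simp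
qed

lemma sup_pres_le_iff:
  assumes "sup_pres L K h" "A \<subseteq> carrier L" "h ` A \<subseteq> carrier K" "z \<in> carrier K"
  shows "h (\<Squnion>\<^bsub>L\<^esub> A) \<sqsubseteq>\<^bsub>K\<^esub> z \<longleftrightarrow> (\<forall>a\<in>A. h a \<sqsubseteq>\<^bsub>K\<^esub> z)"
proof -
  have K: "complete_lattice K" and h: "h (\<Squnion>\<^bsub>L\<^esub> A) = \<Squnion>\<^bsub>K\<^esub> (h ` A)"
    using assms(1,2) by (auto simp: sup_pres_def)
  show ?thesis
    unfolding h using complete_lattice_sup_le_iff[OF K assms(3,4)] by simp
qed


section \<open>Presheaves\<close>

lemma slice_ob_small: "slice_ob Q X \<Longrightarrow> small (pts X)"
  by (simp add: slice_ob_def)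

lemma slice_ob_arr: "slice_ob Q X \<Longrightarrow> x \<in> pts X \<Longrightarrow> arr X x \<in> Ob Q"
  by (auto simp: slice_ob_def)

lemma slice_hom_mem: "f \<in> slice_hom X Y \<Longrightarrow> x \<in> pts X \<Longrightarrow> f x \<in> pts Y"
  by (auto simp: slice_hom_def)

lemma slice_hom_arr: "f \<in> slice_hom X Y \<Longrightarrow> x \<in> pts X \<Longrightarrow> arr Y (f x) = arr X x"
  by (auto simp: slice_hom_def)

lemma slice_hom_PiE: "f \<in> slice_hom X Y \<Longrightarrow> f \<in> pts X \<rightarrow>\<^sub>E pts Y"
  by (auto simp: slice_hom_def)

lemma slice_hom_compose:
  "f \<in> slice_hom X Y \<Longrightarrow> g \<in> slice_hom Y Z \<Longrightarrow> compose (pts X) g f \<in> slice_hom X Z"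
  using slice_hom_mem[of f X Y] slice_hom_arr[of f X Y] slice_hom_mem[of g Y Z] slice_hom_arr[of g Y Z]
  by (simp add: slice_hom_def[of X Z] compose_def)

lemma pts_base [simp]: "pts (base Q) = Ob Q"
  by (simp add: base_def)

lemma arr_base [simp]: "q \<in> Ob Q \<Longrightarrow> arr (base Q) q = q"
  by (simp add: base_def)

lemma pts_P [simp]: "pts (P_ob Q X) = psh_set Q X"
  by (simp add: P_ob_def)

lemma arr_P [simp]: "p \<in> psh_set Q X \<Longrightarrow> arr (P_ob Q X) p = fcod p"
  by (simp add: P_ob_def)

lemma arr_slice_hom: "slice_ob Q X \<Longrightarrow> arr X \<in> slice_hom X (base Q)"
  by (auto simp: slice_ob_def slice_hom_def base_def)

context small_quantaloid
begin

lemma Hom_partial_order: "r \<in> Ob Q \<Longrightarrow> s \<in> Ob Q \<Longrightarrow> partial_order (Hom Q r s)"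
  using Hom_complete complete_lattice.axioms(1) by blast

lemma Hom_refl:
  assumes "r \<in> Ob Q" "s \<in> Ob Q" "f \<in> carrier (Hom Q r s)"
  shows "f \<sqsubseteq>\<^bsub>Hom Q r s\<^esub> f"
proof -
  interpret partial_order "Hom Q r s" using assms(1,2) by (rule Hom_partial_order)
  show ?thesis using assms(3) by simp
qed

lemma Hom_trans:
  assumes "r \<in> Ob Q" "s \<in> Ob Q"
    and "f \<in> carrier (Hom Q r s)" "g \<in> carrier (Hom Q r s)" "h \<in> carrier (Hom Q r s)"
    and "f \<sqsubseteq>\<^bsub>Hom Q r s\<^esub> g" "g \<sqsubseteq>\<^bsub>Hom Q r s\<^esub> h"
  shows "f \<sqsubseteq>\<^bsub>Hom Q r s\<^esub> h"
proof -
  interpret partial_order "Hom Q r s" using assms(1,2) by (rule Hom_partial_order)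
  show ?thesis using assms(3-) by (blast intro: le_trans)
qed

lemma Hom_antisym:
  assumes "r \<in> Ob Q" "s \<in> Ob Q"
    and "f \<in> carrier (Hom Q r s)" "g \<in> carrier (Hom Q r s)"
    and "f \<sqsubseteq>\<^bsub>Hom Q r s\<^esub> g" "g \<sqsubseteq>\<^bsub>Hom Q r s\<^esub> f"
  shows "f = g"
proof -
  interpret partial_order "Hom Q r s" using assms(1,2) by (rule Hom_partial_order)
  show ?thesis using assms(3-) by (blast intro: le_antisym)
qed

lemma Hom_bottom:
  assumes "r \<in> Ob Q" "s \<in> Ob Q"
  shows "\<bottom>\<^bsub>Hom Q r s\<^esub> \<in> carrier (Hom Q r s)"
    and "f \<in> carrier (Hom Q r s) \<Longrightarrow> \<bottom>\<^bsub>Hom Q r s\<^esub> \<sqsubseteq>\<^bsub>Hom Q r s\<^esub> f"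
proof -
  interpret complete_lattice "Hom Q r s" using assms by (rule Hom_complete)
  show "\<bottom>\<^bsub>Hom Q r s\<^esub> \<in> carrier (Hom Q r s)" by simp
  show "f \<in> carrier (Hom Q r s) \<Longrightarrow> \<bottom>\<^bsub>Hom Q r s\<^esub> \<sqsubseteq>\<^bsub>Hom Q r s\<^esub> f" by simp
qed

lemma psh_fcod: "p \<in> psh_set Q X \<Longrightarrow> fcod p \<in> Ob Q"
  by (auto simp: psh_set_def)

lemma psh_fcomp:
  "slice_ob Q X \<Longrightarrow> p \<in> psh_set Q X \<Longrightarrow> x \<in> pts X \<Longrightarrow>
    fcomp p x \<in> carrier (Hom Q (arr X x) (fcod p))"
  by (auto simp: psh_set_def fcomp_fam slice_ob_small)

lemma fam_psh:
  "s \<in> Ob Q \<Longrightarrow> (\<And>x. x \<in> pts X \<Longrightarrow> \<sigma> x \<in> carrier (Hom Q (arr X x) s)) \<Longrightarrow>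
    fam X s \<sigma> \<in> psh_set Q X"
  by (auto simp: psh_set_def)

lemma psh_eqI:
  assumes X: "slice_ob Q X" and p: "p \<in> psh_set Q X" and q: "q \<in> psh_set Q X"
    and cod: "fcod p = fcod q" and comp: "\<And>x. x \<in> pts X \<Longrightarrow> fcomp p x = fcomp q x"
  shows "p = q"
proof -
  obtain s \<sigma> where p': "p = fam X s \<sigma>" using p by (auto simp: psh_set_def)
  obtain s' \<tau> where q': "q = fam X s' \<tau>" using q by (auto simp: psh_set_def)
  have "\<sigma> x = \<tau> x" if "x \<in> pts X" for x
    using comp[OF that] that X by (simp add: p' q' fcomp_fam slice_ob_small)
  then have "graph (pts X) \<sigma> = graph (pts X) \<tau>"
    by (simp add: graph_def cong: image_cong)
  with cod show ?thesis
    by (simp add: p' q') (simp add: fam_def)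
qed

lemma psh_le_refl: "slice_ob Q X \<Longrightarrow> p \<in> psh_set Q X \<Longrightarrow> psh_le Q X p p"
  by (simp add: psh_le_def Hom_refl slice_ob_arr psh_fcod psh_fcomp)

lemma psh_le_trans:
  assumes X: "slice_ob Q X"
    and p: "p \<in> psh_set Q X" "q \<in> psh_set Q X" "r \<in> psh_set Q X"
    and le: "psh_le Q X p q" "psh_le Q X q r"
  shows "psh_le Q X p r"
  unfolding psh_le_def
proof (intro conjI ballI)
  have cod: "fcod q = fcod p" "fcod r = fcod p"
    using le by (simp_all add: psh_le_def)
  then show "fcod p = fcod r" by simp
  fix x assume x: "x \<in> pts X"
  have "fcomp p x \<sqsubseteq>\<^bsub>Hom Q (arr X x) (fcod p)\<^esub> fcomp q x"
    "fcomp q x \<sqsubseteq>\<^bsub>Hom Q (arr X x) (fcod q)\<^esub> fcomp r x"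
    using le x unfolding psh_le_def by blast+
  then show "fcomp p x \<sqsubseteq>\<^bsub>Hom Q (arr X x) (fcod p)\<^esub> fcomp r x"
    using Hom_trans[OF slice_ob_arr[OF X x] psh_fcod[OF p(1)], of "fcomp p x" "fcomp q x" "fcomp r x"]
      psh_fcomp[OF X p(1) x] psh_fcomp[OF X p(2) x] psh_fcomp[OF X p(3) x]
    by (simp add: cod)
qed

lemma psh_le_antisym:
  assumes X: "slice_ob Q X" and p: "p \<in> psh_set Q X" "q \<in> psh_set Q X"
    and le: "psh_le Q X p q" "psh_le Q X q p"
  shows "p = q"
proof (rule psh_eqI[OF X p])
  show cod: "fcod p = fcod q"
    using le by (simp add: psh_le_def)
  fix x assume x: "x \<in> pts X"
  have "fcomp p x \<sqsubseteq>\<^bsub>Hom Q (arr X x) (fcod p)\<^esub> fcomp q x"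
    "fcomp q x \<sqsubseteq>\<^bsub>Hom Q (arr X x) (fcod q)\<^esub> fcomp p x"
    using le x unfolding psh_le_def by blast+
  then show "fcomp p x = fcomp q x"
    using Hom_antisym[OF slice_ob_arr[OF X x] psh_fcod[OF p(2)], of "fcomp p x" "fcomp q x"]
      psh_fcomp[OF X p(1) x] psh_fcomp[OF X p(2) x]
    by (simp add: cod)
qed

text \<open>
  Direct images, Yoneda presheaves and \<open>psup\<close> are all defined by suprema, and are best known
  through their upper bounds. Equations between composites of them, such as functoriality and
  naturality, are therefore proved by comparing upper bounds.
\<close>

lemma psh_eq_if_same_upper_bounds:
  assumes "slice_ob Q X" "p \<in> psh_set Q X" "p' \<in> psh_set Q X"
    and "\<And>q. q \<in> psh_set Q X \<Longrightarrow> psh_le Q X p q \<longleftrightarrow> psh_le Q X p' q"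
  shows "p = p'"
  using assms(4)[of p] assms(4)[of p'] psh_le_refl[OF assms(1)] assms(2,3)
  by (intro psh_le_antisym[OF assms(1-3)]) simp_all


section \<open>Direct and inverse images\<close>

lemma
  assumes X: "slice_ob Q X" and Y: "slice_ob Q Y" and f: "f \<in> slice_hom X Y"
    and p: "p \<in> psh_set Q X"
  shows push_psh: "push Q X Y f p \<in> psh_set Q Y"
    and fcod_push: "fcod (push Q X Y f p) = fcod p"
    and fcomp_push: "y \<in> pts Y \<Longrightarrow> fcomp (push Q X Y f p) y
      = \<Squnion>\<^bsub>Hom Q (arr Y y) (fcod p)\<^esub> {fcomp p x | x. x \<in> pts X \<and> f x = y}"
    and fibre_subset: "{fcomp p x | x. x \<in> pts X \<and> f x = y} \<subseteq> carrier (Hom Q (arr Y y) (fcod p))"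
proof -
  show sub: "{fcomp p x | x. x \<in> pts X \<and> f x = y} \<subseteq> carrier (Hom Q (arr Y y) (fcod p))" for y
  proof clarify
    fix x assume x: "x \<in> pts X"
    show "fcomp p x \<in> carrier (Hom Q (arr Y (f x)) (fcod p))"
      using psh_fcomp[OF X p x] slice_hom_arr[OF f x] by simp
  qed
  show "push Q X Y f p \<in> psh_set Q Y"
    unfolding push_def restrict_apply if_P[OF p]
    by (intro fam_psh psh_fcod[OF p]
        complete_lattice_sup_closed[OF Hom_complete[OF slice_ob_arr[OF Y] psh_fcod[OF p]] sub])
  show "fcod (push Q X Y f p) = fcod p"
    using p by (simp add: push_def)
  show "fcomp (push Q X Y f p) y
      = \<Squnion>\<^bsub>Hom Q (arr Y y) (fcod p)\<^esub> {fcomp p x | x. x \<in> pts X \<and> f x = y}" if "y \<in> pts Y"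
    using p that Y by (simp add: push_def fcomp_fam slice_ob_small)
qed

lemma push_slice_hom:
  "slice_ob Q X \<Longrightarrow> slice_ob Q Y \<Longrightarrow> f \<in> slice_hom X Y \<Longrightarrow>
    push Q X Y f \<in> slice_hom (P_ob Q X) (P_ob Q Y)"
  using push_psh[of X Y f] fcod_push[of X Y f]
  by (simp add: slice_hom_def[of "P_ob Q X"] PiE_def Pi_def) (simp add: push_def)

lemma
  assumes X: "slice_ob Q X" and Y: "slice_ob Q Y" and f: "f \<in> slice_hom X Y"
    and q: "q \<in> psh_set Q Y"
  shows pull_psh: "pull Q X Y f q \<in> psh_set Q X"
    and fcod_pull: "fcod (pull Q X Y f q) = fcod q"
    and fcomp_pull: "x \<in> pts X \<Longrightarrow> fcomp (pull Q X Y f q) x = fcomp q (f x)"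
proof -
  have "fcomp q (f x) \<in> carrier (Hom Q (arr X x) (fcod q))" if "x \<in> pts X" for x
    using psh_fcomp[OF Y q slice_hom_mem[OF f that]] slice_hom_arr[OF f that] by simp
  then show "pull Q X Y f q \<in> psh_set Q X"
    using q by (auto simp: pull_def intro!: fam_psh psh_fcod)
  show "fcod (pull Q X Y f q) = fcod q"
    using q by (simp add: pull_def)
  show "fcomp (pull Q X Y f q) x = fcomp q (f x)" if "x \<in> pts X"
    using q that X by (simp add: pull_def fcomp_fam slice_ob_small)
qed

lemma pull_slice_hom:
  "slice_ob Q X \<Longrightarrow> slice_ob Q Y \<Longrightarrow> f \<in> slice_hom X Y \<Longrightarrow>
    pull Q X Y f \<in> slice_hom (P_ob Q Y) (P_ob Q X)"
  using pull_psh[of X Y f] fcod_pull[of X Y f]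
  by (simp add: slice_hom_def[of "P_ob Q Y"] PiE_def Pi_def) (simp add: pull_def)

text \<open>
  The suprema in a direct image disappear when it is compared with a presheaf above it: the
  conditions over the fibres of \<open>f\<close> add up to one over all points of the domain.
\<close>

lemma push_le_iff:
  assumes X: "slice_ob Q X" and Y: "slice_ob Q Y" and f: "f \<in> slice_hom X Y"
    and p: "p \<in> psh_set Q X" and q: "q \<in> psh_set Q Y"
  shows "psh_le Q Y (push Q X Y f p) q \<longleftrightarrow> fcod p = fcod q \<and>
    (\<forall>x\<in>pts X. fcomp p x \<sqsubseteq>\<^bsub>Hom Q (arr X x) (fcod p)\<^esub> fcomp q (f x))"
proof -
  have "fcomp (push Q X Y f p) y \<sqsubseteq>\<^bsub>Hom Q (arr Y y) (fcod p)\<^esub> fcomp q y \<longleftrightarrow>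
      (\<forall>x\<in>pts X. f x = y \<longrightarrow> fcomp p x \<sqsubseteq>\<^bsub>Hom Q (arr Y y) (fcod p)\<^esub> fcomp q y)"
    if y: "y \<in> pts Y" and cod: "fcod p = fcod q" for y
    unfolding fcomp_push[OF X Y f p y]
    using complete_lattice_sup_le_iff[OF Hom_complete[OF slice_ob_arr[OF Y y] psh_fcod[OF p]]
        fibre_subset[OF X Y f p, of y], of "fcomp q y"] psh_fcomp[OF Y q y] cod
    by (simp only: simp_thms) blast
  then have "psh_le Q Y (push Q X Y f p) q \<longleftrightarrow> fcod p = fcod q \<and>
      (\<forall>y\<in>pts Y. \<forall>x\<in>pts X. f x = y \<longrightarrow> fcomp p x \<sqsubseteq>\<^bsub>Hom Q (arr Y y) (fcod p)\<^esub> fcomp q y)"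
    unfolding psh_le_def fcod_push[OF X Y f p] by blast
  also have "\<dots> \<longleftrightarrow> fcod p = fcod q \<and>
      (\<forall>x\<in>pts X. fcomp p x \<sqsubseteq>\<^bsub>Hom Q (arr Y (f x)) (fcod p)\<^esub> fcomp q (f x))"
    using slice_hom_mem[OF f] by blast
  finally show ?thesis
    by (simp add: slice_hom_arr[OF f] cong: ball_cong)
qed

lemma push_pull_adjoint:
  assumes X: "slice_ob Q X" and Y: "slice_ob Q Y" and f: "f \<in> slice_hom X Y"
    and p: "p \<in> psh_set Q X" and q: "q \<in> psh_set Q Y"
  shows "psh_le Q Y (push Q X Y f p) q \<longleftrightarrow> psh_le Q X p (pull Q X Y f q)"
  using push_le_iff[OF assms] fcod_pull[OF X Y f q] fcomp_pull[OF X Y f q]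
  by (auto simp: psh_le_def)

lemma pull_mono:
  assumes "slice_ob Q X" "slice_ob Q Y" "f \<in> slice_hom X Y"
    and "q \<in> psh_set Q Y" "q' \<in> psh_set Q Y" "psh_le Q Y q q'"
  shows "psh_le Q X (pull Q X Y f q) (pull Q X Y f q')"
proof -
  have "fcomp q (f x) \<sqsubseteq>\<^bsub>Hom Q (arr X x) (fcod q)\<^esub> fcomp q' (f x)" if "x \<in> pts X" for x
    using assms(6) slice_hom_mem[OF assms(3) that] slice_hom_arr[OF assms(3) that]
    unfolding psh_le_def by metis
  then show ?thesis
    using assms(6) fcod_pull[OF assms(1-3)] fcomp_pull[OF assms(1-3)] assms(4,5)
    by (simp add: psh_le_def)
qed

lemma push_mono:
  assumes "slice_ob Q X" "slice_ob Q Y" "f \<in> slice_hom X Y"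
    and "p \<in> psh_set Q X" "p' \<in> psh_set Q X" "psh_le Q X p p'"
  shows "psh_le Q Y (push Q X Y f p) (push Q X Y f p')"
proof -
  have q: "push Q X Y f p' \<in> psh_set Q Y"
    by (rule push_psh[OF assms(1-3,5)])
  have "psh_le Q X p' (pull Q X Y f (push Q X Y f p'))"
    using push_pull_adjoint[OF assms(1-3,5) q] psh_le_refl[OF assms(2) q] by simp
  then have "psh_le Q X p (pull Q X Y f (push Q X Y f p'))"
    using psh_le_trans[OF assms(1,4,5) pull_psh[OF assms(1-3) q] assms(6)] by simp
  then show ?thesis
    using push_pull_adjoint[OF assms(1-3,4) q] by simp
qed

lemma pull_compose:
  assumes "slice_ob Q X" "slice_ob Q Y" "slice_ob Q Z" "f \<in> slice_hom X Y" "g \<in> slice_hom Y Z"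
    and h: "h \<in> slice_hom X Z" "\<And>x. x \<in> pts X \<Longrightarrow> h x = g (f x)"
    and "q \<in> psh_set Q Z"
  shows "pull Q X Z h q = pull Q X Y f (pull Q Y Z g q)"
proof (rule psh_eqI[OF assms(1)])
  note q = pull_psh[OF assms(2,3,5,8)]
  show "pull Q X Z h q \<in> psh_set Q X" "pull Q X Y f (pull Q Y Z g q) \<in> psh_set Q X"
    using pull_psh[OF assms(1,3) h(1) assms(8)] pull_psh[OF assms(1,2,4) q] .
  show "fcod (pull Q X Z h q) = fcod (pull Q X Y f (pull Q Y Z g q))"
    unfolding fcod_pull[OF assms(1,3) h(1) assms(8)] fcod_pull[OF assms(1,2,4) q]
      fcod_pull[OF assms(2,3,5,8)] ..
  fix x assume x: "x \<in> pts X"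
  show "fcomp (pull Q X Z h q) x = fcomp (pull Q X Y f (pull Q Y Z g q)) x"
    unfolding fcomp_pull[OF assms(1,3) h(1) assms(8) x] fcomp_pull[OF assms(1,2,4) q x]
      fcomp_pull[OF assms(2,3,5,8) slice_hom_mem[OF assms(4) x]] h(2)[OF x] ..
qed

text \<open>By adjointness this is the evident functoriality of inverse images.\<close>

lemma push_compose:
  assumes "slice_ob Q X" "slice_ob Q Y" "slice_ob Q Z" "f \<in> slice_hom X Y" "g \<in> slice_hom Y Z"
    and "h \<in> slice_hom X Z" "\<And>x. x \<in> pts X \<Longrightarrow> h x = g (f x)"
    and "p \<in> psh_set Q X"
  shows "push Q X Z h p = push Q Y Z g (push Q X Y f p)"
proof (rule psh_eq_if_same_upper_bounds[OF assms(3)])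
  note p = push_psh[OF assms(1,2,4,8)]
  show "push Q X Z h p \<in> psh_set Q Z" "push Q Y Z g (push Q X Y f p) \<in> psh_set Q Z"
    using push_psh[OF assms(1,3,6,8)] push_psh[OF assms(2,3,5) p] .
  fix q assume q: "q \<in> psh_set Q Z"
  show "psh_le Q Z (push Q X Z h p) q \<longleftrightarrow> psh_le Q Z (push Q Y Z g (push Q X Y f p)) q"
    by (simp only: push_pull_adjoint[OF assms(1,3,6,8) q] push_pull_adjoint[OF assms(2,3,5) p q]
        push_pull_adjoint[OF assms(1,2,4,8) pull_psh[OF assms(2,3,5) q]] pull_compose[OF assms(1-7) q])
qed

lemma push_id:
  assumes X: "slice_ob Q X" and p: "p \<in> psh_set Q X"
    and f: "f \<in> slice_hom X X" "\<And>x. x \<in> pts X \<Longrightarrow> f x = x"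
  shows "push Q X X f p = p"
proof (rule psh_eq_if_same_upper_bounds[OF X push_psh[OF X X f(1) p] p])
  fix q assume "q \<in> psh_set Q X"
  then show "psh_le Q X (push Q X X f p) q \<longleftrightarrow> psh_le Q X p q"
    unfolding push_le_iff[OF X X f(1) p \<open>q \<in> psh_set Q X\<close>] unfolding psh_le_def
    by (simp add: f(2))
qed

lemma push_pull_surj:
  assumes X: "slice_ob Q X" and Y: "slice_ob Q Y" and f: "f \<in> slice_hom X Y"
    and q: "q \<in> psh_set Q Y" and surj: "\<And>y. y \<in> pts Y \<Longrightarrow> \<exists>x\<in>pts X. f x = y"
  shows "push Q X Y f (pull Q X Y f q) = q"
proof (rule psh_eq_if_same_upper_bounds[OF Y push_psh[OF X Y f pull_psh[OF X Y f q]] q])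
  fix r assume r: "r \<in> psh_set Q Y"
  have "psh_le Q Y (push Q X Y f (pull Q X Y f q)) r \<longleftrightarrow> fcod q = fcod r \<and>
      (\<forall>x\<in>pts X. fcomp q (f x) \<sqsubseteq>\<^bsub>Hom Q (arr Y (f x)) (fcod q)\<^esub> fcomp r (f x))"
    using push_le_iff[OF X Y f pull_psh[OF X Y f q] r]
    by (simp add: fcod_pull[OF X Y f q] fcomp_pull[OF X Y f q] slice_hom_arr[OF f] cong: ball_cong)
  also have "\<dots> \<longleftrightarrow> psh_le Q Y q r"
    unfolding psh_le_def using surj slice_hom_mem[OF f] by metis
  finally show "psh_le Q Y (push Q X Y f (pull Q X Y f q)) r \<longleftrightarrow> psh_le Q Y q r" .
qed


section \<open>The Yoneda maps and the suprema of presheaves\<close>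

lemma
  assumes X: "slice_ob Q X" and x: "x \<in> pts X"
  shows yon_psh: "yon Q X x \<in> psh_set Q X"
    and fcod_yon: "fcod (yon Q X x) = arr X x"
    and fcomp_yon: "z \<in> pts X \<Longrightarrow> fcomp (yon Q X x) z
      = (if z = x then Idn Q (arr X x) else \<bottom>\<^bsub>Hom Q (arr X z) (arr X x)\<^esub>)"
  using x slice_ob_arr[OF X]
  by (auto simp: yon_def fcomp_fam slice_ob_small[OF X] Idn_closed Hom_bottom intro!: fam_psh)

lemma yon_slice_hom: "slice_ob Q X \<Longrightarrow> yon Q X \<in> slice_hom X (P_ob Q X)"
  using yon_psh[of X] fcod_yon[of X]
  by (simp add: slice_hom_def PiE_def Pi_def) (simp add: yon_def)

text \<open>
  The Yoneda lemma: the components of a Yoneda presheaf are bottom elements except for one identity,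
  so a single component decides whether it lies below \<open>q\<close>.
\<close>

lemma yon_le_iff:
  assumes X: "slice_ob Q X" and x: "x \<in> pts X" and q: "q \<in> psh_set Q X"
  shows "psh_le Q X (yon Q X x) q \<longleftrightarrow>
    arr X x = fcod q \<and> Idn Q (arr X x) \<sqsubseteq>\<^bsub>Hom Q (arr X x) (arr X x)\<^esub> fcomp q x"
proof -
  have "fcomp (yon Q X x) z \<sqsubseteq>\<^bsub>Hom Q (arr X z) (arr X x)\<^esub> fcomp q z"
    if "z \<in> pts X" "z \<noteq> x" "arr X x = fcod q" for z
    using psh_fcomp[OF X q that(1)] that
    by (simp add: fcomp_yon[OF X x] Hom_bottom slice_ob_arr[OF X] psh_fcod[OF q])
  then show ?thesis
    unfolding psh_le_def fcod_yon[OF X x] using fcomp_yon[OF X x x] x by metis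
qed

lemma yon_natural:
  assumes X: "slice_ob Q X" and Y: "slice_ob Q Y" and f: "f \<in> slice_hom X Y" and x: "x \<in> pts X"
  shows "push Q X Y f (yon Q X x) = yon Q Y (f x)"
proof (rule psh_eq_if_same_upper_bounds[OF Y])
  note y = slice_hom_mem[OF f x]
  show "push Q X Y f (yon Q X x) \<in> psh_set Q Y" "yon Q Y (f x) \<in> psh_set Q Y"
    using push_psh[OF X Y f yon_psh[OF X x]] yon_psh[OF Y y] .
  fix q assume q: "q \<in> psh_set Q Y"
  show "psh_le Q Y (push Q X Y f (yon Q X x)) q \<longleftrightarrow> psh_le Q Y (yon Q Y (f x)) q"
    by (simp only: push_pull_adjoint[OF X Y f yon_psh[OF X x] q] yon_le_iff[OF Y y q]
        yon_le_iff[OF X x pull_psh[OF X Y f q]] fcod_pull[OF X Y f q] fcomp_pull[OF X Y f q x]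
        slice_hom_arr[OF f x])
qed

text \<open>
  Composition preserves suprema in each variable, so it passes through the suprema of a direct
  image.
\<close>

lemma Comp_fcomp_push_le_iff:
  assumes X: "slice_ob Q X" and Y: "slice_ob Q Y" and f: "f \<in> slice_hom X Y"
    and p: "p \<in> psh_set Q X" and y: "y \<in> pts Y" and t: "t \<in> Ob Q"
    and g: "g \<in> carrier (Hom Q (fcod p) t)" and z: "z \<in> carrier (Hom Q (arr Y y) t)"
  shows "Comp Q (arr Y y) (fcod p) t g (fcomp (push Q X Y f p) y) \<sqsubseteq>\<^bsub>Hom Q (arr Y y) t\<^esub> z \<longleftrightarrow>
    (\<forall>x\<in>pts X. f x = y \<longrightarrow> Comp Q (arr Y y) (fcod p) t g (fcomp p x) \<sqsubseteq>\<^bsub>Hom Q (arr Y y) t\<^esub> z)"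
proof -
  let ?A = "{fcomp p x | x. x \<in> pts X \<and> f x = y}"
  note ob = slice_ob_arr[OF Y y] psh_fcod[OF p] t
  note A = fibre_subset[OF X Y f p, of y]
  have "Comp Q (arr Y y) (fcod p) t g ` ?A \<subseteq> carrier (Hom Q (arr Y y) t)"
    using A Comp_closed[OF ob _ g] by blast
  from sup_pres_le_iff[OF Comp_sup_right[OF ob g] A this z] show ?thesis
    unfolding fcomp_push[OF X Y f p y] by blast
qed

lemma Comp_push_fcomp_le_iff:
  assumes X: "slice_ob Q X" and Y: "slice_ob Q Y" and f: "f \<in> slice_hom X Y"
    and p: "p \<in> psh_set Q X" and y: "y \<in> pts Y" and r: "r \<in> Ob Q"
    and h: "h \<in> carrier (Hom Q r (arr Y y))" and z: "z \<in> carrier (Hom Q r (fcod p))"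
  shows "Comp Q r (arr Y y) (fcod p) (fcomp (push Q X Y f p) y) h \<sqsubseteq>\<^bsub>Hom Q r (fcod p)\<^esub> z \<longleftrightarrow>
    (\<forall>x\<in>pts X. f x = y \<longrightarrow> Comp Q r (arr Y y) (fcod p) (fcomp p x) h \<sqsubseteq>\<^bsub>Hom Q r (fcod p)\<^esub> z)"
proof -
  let ?A = "{fcomp p x | x. x \<in> pts X \<and> f x = y}"
  note ob = r slice_ob_arr[OF Y y] psh_fcod[OF p]
  note A = fibre_subset[OF X Y f p, of y]
  have "(\<lambda>g. Comp Q r (arr Y y) (fcod p) g h) ` ?A \<subseteq> carrier (Hom Q r (fcod p))"
    using A Comp_closed[OF ob h] by blast
  from sup_pres_le_iff[OF Comp_sup_left[OF ob h] A this z] show ?thesis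
    unfolding fcomp_push[OF X Y f p y] by blast
qed

lemma psh_fcomp_P:
  "slice_ob Q X \<Longrightarrow> S \<in> psh_set Q (P_ob Q X) \<Longrightarrow> p \<in> psh_set Q X \<Longrightarrow>
    fcomp S p \<in> carrier (Hom Q (fcod p) (fcod S))"
  using psh_fcomp[OF slice_ob_P, of X S p] by simp

lemma
  assumes X: "slice_ob Q X" and S: "S \<in> psh_set Q (P_ob Q X)"
  shows psup_psh: "psup Q X S \<in> psh_set Q X"
    and fcod_psup: "fcod (psup Q X S) = fcod S"
    and psup_le_iff: "q \<in> psh_set Q X \<Longrightarrow> psh_le Q X (psup Q X S) q \<longleftrightarrow> fcod S = fcod q \<and>
      (\<forall>p\<in>psh_set Q X. \<forall>x\<in>pts X. Comp Q (arr X x) (fcod p) (fcod S) (fcomp S p) (fcomp p x)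
        \<sqsubseteq>\<^bsub>Hom Q (arr X x) (fcod S)\<^esub> fcomp q x)"
proof -
  let ?A = "\<lambda>x. {Comp Q (arr X x) (fcod p) (fcod S) (fcomp S p) (fcomp p x) | p. p \<in> psh_set Q X}"
  have A: "?A x \<subseteq> carrier (Hom Q (arr X x) (fcod S))" if "x \<in> pts X" for x
    using Comp_closed[OF slice_ob_arr[OF X that] psh_fcod psh_fcod[OF S] psh_fcomp[OF X _ that]
        psh_fcomp_P[OF X S]] by blast
  note complete = Hom_complete[OF slice_ob_arr[OF X] psh_fcod[OF S]]
  show "psup Q X S \<in> psh_set Q X"
    unfolding psup_def restrict_apply if_P[OF S]
    by (intro fam_psh psh_fcod[OF S] complete_lattice_sup_closed[OF complete A])
  show cod: "fcod (psup Q X S) = fcod S"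
    using S by (simp add: psup_def)
  have comp: "fcomp (psup Q X S) x = \<Squnion>\<^bsub>Hom Q (arr X x) (fcod S)\<^esub> ?A x" if "x \<in> pts X" for x
    using S that by (simp add: psup_def fcomp_fam slice_ob_small[OF X])
  assume q: "q \<in> psh_set Q X"
  have "fcomp (psup Q X S) x \<sqsubseteq>\<^bsub>Hom Q (arr X x) (fcod S)\<^esub> fcomp q x \<longleftrightarrow>
      (\<forall>a\<in>?A x. a \<sqsubseteq>\<^bsub>Hom Q (arr X x) (fcod S)\<^esub> fcomp q x)"
    if x: "x \<in> pts X" and c: "fcod S = fcod q" for x
    unfolding comp[OF x]
    using complete_lattice_sup_le_iff[OF complete[OF x] A[OF x], of "fcomp q x"]
      psh_fcomp[OF X q x] by (simp only: c simp_thms)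
  then show "psh_le Q X (psup Q X S) q \<longleftrightarrow> fcod S = fcod q \<and>
      (\<forall>p\<in>psh_set Q X. \<forall>x\<in>pts X. Comp Q (arr X x) (fcod p) (fcod S) (fcomp S p) (fcomp p x)
        \<sqsubseteq>\<^bsub>Hom Q (arr X x) (fcod S)\<^esub> fcomp q x)"
    unfolding psh_le_def cod by blast
qed

lemma psup_slice_hom:
  "slice_ob Q X \<Longrightarrow> psup Q X \<in> slice_hom (P_ob Q (P_ob Q X)) (P_ob Q X)"
  using psup_psh[of X] fcod_psup[of X]
  by (simp add: slice_hom_def PiE_def Pi_def) (simp add: psup_def)

text \<open>
  The composite of \<open>psup\<close> with the direct image of \<open>f\<close> is the Kleisli extension of \<open>f\<close>: its value at
  \<open>S\<close> is the supremum of the composites of \<open>S\<close> with the presheaves \<open>f y\<close>, indexed by the points \<open>y\<close>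
  instead of by all presheaves.
\<close>

lemma psup_push_le_iff:
  assumes X: "slice_ob Q X" and Y: "slice_ob Q Y" and f: "f \<in> slice_hom Y (P_ob Q X)"
    and S: "S \<in> psh_set Q Y" and q: "q \<in> psh_set Q X"
  shows "psh_le Q X (psup Q X (push Q Y (P_ob Q X) f S)) q \<longleftrightarrow> fcod S = fcod q \<and>
    (\<forall>y\<in>pts Y. \<forall>x\<in>pts X. Comp Q (arr X x) (arr Y y) (fcod S) (fcomp S y) (fcomp (f y) x)
      \<sqsubseteq>\<^bsub>Hom Q (arr X x) (fcod S)\<^esub> fcomp q x)"
proof -
  note P = slice_ob_P[OF X]
  note S' = push_psh[OF Y P f S]
  have "Comp Q (arr X x) (fcod p) (fcod S) (fcomp (push Q Y (P_ob Q X) f S) p) (fcomp p x)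
        \<sqsubseteq>\<^bsub>Hom Q (arr X x) (fcod S)\<^esub> fcomp q x \<longleftrightarrow>
      (\<forall>y\<in>pts Y. f y = p \<longrightarrow> Comp Q (arr X x) (fcod p) (fcod S) (fcomp S y) (fcomp p x)
        \<sqsubseteq>\<^bsub>Hom Q (arr X x) (fcod S)\<^esub> fcomp q x)"
    if "fcod S = fcod q" "p \<in> psh_set Q X" "x \<in> pts X" for p x
    using Comp_push_fcomp_le_iff[OF Y P f S, of p "arr X x" "fcomp p x" "fcomp q x"] that
      slice_ob_arr[OF X that(3)] psh_fcomp[OF X that(2,3)] psh_fcomp[OF X q that(3)]
    by simp
  then have "psh_le Q X (psup Q X (push Q Y (P_ob Q X) f S)) q \<longleftrightarrow> fcod S = fcod q \<and>
      (\<forall>p\<in>psh_set Q X. \<forall>x\<in>pts X. \<forall>y\<in>pts Y. f y = p \<longrightarrow>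
        Comp Q (arr X x) (fcod p) (fcod S) (fcomp S y) (fcomp p x)
          \<sqsubseteq>\<^bsub>Hom Q (arr X x) (fcod S)\<^esub> fcomp q x)"
    unfolding psup_le_iff[OF X S' q] fcod_push[OF Y P f S] by blast
  also have "\<dots> \<longleftrightarrow> fcod S = fcod q \<and> (\<forall>y\<in>pts Y. \<forall>x\<in>pts X.
      Comp Q (arr X x) (fcod (f y)) (fcod S) (fcomp S y) (fcomp (f y) x)
        \<sqsubseteq>\<^bsub>Hom Q (arr X x) (fcod S)\<^esub> fcomp q x)"
    using slice_hom_mem[OF f, unfolded pts_P] by blast
  also have "\<dots> \<longleftrightarrow> fcod S = fcod q \<and> (\<forall>y\<in>pts Y. \<forall>x\<in>pts X.
      Comp Q (arr X x) (arr Y y) (fcod S) (fcomp S y) (fcomp (f y) x)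
        \<sqsubseteq>\<^bsub>Hom Q (arr X x) (fcod S)\<^esub> fcomp q x)"
    using slice_hom_arr[OF f] slice_hom_mem[OF f] by (simp cong: ball_cong)
  finally show ?thesis .
qed

lemma psup_natural:
  assumes X: "slice_ob Q X" and Y: "slice_ob Q Y" and f: "f \<in> slice_hom X Y"
    and S: "S \<in> psh_set Q (P_ob Q X)"
  shows "push Q X Y f (psup Q X S) = psup Q Y (push Q (P_ob Q X) (P_ob Q Y) (push Q X Y f) S)"
proof (rule psh_eq_if_same_upper_bounds[OF Y])
  note P = slice_ob_P[OF X] slice_ob_P[OF Y]
  note f' = push_slice_hom[OF X Y f]
  show "push Q X Y f (psup Q X S) \<in> psh_set Q Y"
    by (rule push_psh[OF X Y f psup_psh[OF X S]])
  show "psup Q Y (push Q (P_ob Q X) (P_ob Q Y) (push Q X Y f) S) \<in> psh_set Q Y"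
    by (rule psup_psh[OF Y push_psh[OF P f' S]])
  fix q assume q: "q \<in> psh_set Q Y"
  have "psh_le Q Y (psup Q Y (push Q (P_ob Q X) (P_ob Q Y) (push Q X Y f) S)) q \<longleftrightarrow>
      fcod S = fcod q \<and> (\<forall>p\<in>psh_set Q X. \<forall>y\<in>pts Y.
        Comp Q (arr Y y) (fcod p) (fcod S) (fcomp S p) (fcomp (push Q X Y f p) y)
          \<sqsubseteq>\<^bsub>Hom Q (arr Y y) (fcod S)\<^esub> fcomp q y)"
    using psup_push_le_iff[OF Y P(1) f' S q] by (simp cong: ball_cong)
  also have "\<dots> \<longleftrightarrow> fcod S = fcod q \<and> (\<forall>p\<in>psh_set Q X. \<forall>y\<in>pts Y. \<forall>x\<in>pts X. f x = y \<longrightarrow>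
        Comp Q (arr Y y) (fcod p) (fcod S) (fcomp S p) (fcomp p x)
          \<sqsubseteq>\<^bsub>Hom Q (arr Y y) (fcod S)\<^esub> fcomp q y)"
    using Comp_fcomp_push_le_iff[OF X Y f _ _ psh_fcod[OF S] psh_fcomp_P[OF X S]]
      psh_fcomp[OF Y q] by (metis (no_types, lifting))
  also have "\<dots> \<longleftrightarrow> fcod S = fcod q \<and> (\<forall>p\<in>psh_set Q X. \<forall>x\<in>pts X.
        Comp Q (arr Y (f x)) (fcod p) (fcod S) (fcomp S p) (fcomp p x)
          \<sqsubseteq>\<^bsub>Hom Q (arr Y (f x)) (fcod S)\<^esub> fcomp q (f x))"
    using slice_hom_mem[OF f] by blast
  also have "\<dots> \<longleftrightarrow> psh_le Q X (psup Q X S) (pull Q X Y f q)"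
    unfolding psup_le_iff[OF X S pull_psh[OF X Y f q]]
    by (simp add: fcod_pull[OF X Y f q] fcomp_pull[OF X Y f q] slice_hom_arr[OF f] cong: ball_cong)
  also have "\<dots> \<longleftrightarrow> psh_le Q Y (push Q X Y f (psup Q X S)) q"
    using push_pull_adjoint[OF X Y f psup_psh[OF X S] q] ..
  finally show "psh_le Q Y (push Q X Y f (psup Q X S)) q \<longleftrightarrow>
      psh_le Q Y (psup Q Y (push Q (P_ob Q X) (P_ob Q Y) (push Q X Y f) S)) q" ..
qed

end


section \<open>The monad on the slice category\<close>

locale slice_monad = small_quantaloid Q + monad_on_Set M
  for Q :: "'u::set_universe quantaloid" and M :: "'u set_monad" +
  fixes \<zeta> :: "'u \<Rightarrow> 'u"
  assumes algebra: "em_algebra M (Ob Q) \<zeta>"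
begin

abbreviation B :: "'u slice" where "B \<equiv> base Q"
abbreviation P :: "'u slice \<Rightarrow> 'u slice" where "P \<equiv> P_ob Q"
abbreviation T :: "'u slice \<Rightarrow> 'u slice" where "T \<equiv> T_ob Q M \<zeta>"

lemma slice_B: "slice_ob Q B"
  by (rule slice_ob_base) (rule small_quantaloid_axioms)

lemma slice_T: "slice_ob Q X \<Longrightarrow> slice_ob Q (T X)"
  by (rule slice_ob_T[OF monad_on_Set_axioms algebra])

lemma pts_T: "pts (T X) = Tob M (pts X)"
  by (simp add: T_ob_def)

lemma arr_T: "w \<in> pts (T X) \<Longrightarrow> arr (T X) w = \<zeta> (T_map M X B (arr X) w)"
  by (simp add: T_ob_def T_map_def compose_def)

lemma zeta_ret: "q \<in> Ob Q \<Longrightarrow> \<zeta> (ret M (Ob Q) q) = q"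
  using algebra by (auto simp: em_algebra_def compose_def fun_eq_iff split: if_splits)

lemma zeta_mul: "w \<in> Tob M (Tob M (Ob Q)) \<Longrightarrow>
    \<zeta> (mul M (Ob Q) w) = \<zeta> (Tmap M (Tob M (Ob Q)) (Ob Q) \<zeta> w)"
  using algebra by (auto simp: em_algebra_def compose_def fun_eq_iff split: if_splits)

lemma zeta_closed: "\<zeta> \<in> Tob M (Ob Q) \<rightarrow>\<^sub>E Ob Q"
  using algebra by (simp add: em_algebra_def)

lemma T_map_mem:
  assumes "slice_ob Q X" "slice_ob Q Y" "f \<in> slice_hom X Y" "w \<in> pts (T X)"
  shows "T_map M X Y f w \<in> pts (T Y)"
  using PiE_mem[OF Tmap_closed[OF slice_ob_small[OF assms(1)] slice_ob_small[OF assms(2)]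
        slice_hom_PiE[OF assms(3)]]] assms(4)
  by (simp add: pts_T T_map_def)

lemma T_map_compose:
  assumes X: "slice_ob Q X" and Y: "slice_ob Q Y" and Z: "slice_ob Q Z"
    and f: "f \<in> slice_hom X Y" and g: "g \<in> slice_hom Y Z"
    and h: "h \<in> slice_hom X Z" "\<And>x. x \<in> pts X \<Longrightarrow> h x = g (f x)"
    and w: "w \<in> pts (T X)"
  shows "T_map M X Z h w = T_map M Y Z g (T_map M X Y f w)"
proof -
  have "h = compose (pts X) g f"
    by (rule extensionalityI[where A = "pts X"])
      (use slice_hom_PiE[OF h(1)] in \<open>auto simp: compose_eq h(2) PiE_def\<close>)
  then show ?thesis
    using Tmap_compose[OF slice_ob_small[OF X] slice_ob_small[OF Y] slice_ob_small[OF Z]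
        slice_hom_PiE[OF f] slice_hom_PiE[OF g]] w
    by (simp add: T_map_def pts_T compose_eq)
qed

lemma T_map_id:
  assumes X: "slice_ob Q X" and f: "f \<in> slice_hom X X" "\<And>x. x \<in> pts X \<Longrightarrow> f x = x"
    and w: "w \<in> pts (T X)"
  shows "T_map M X X f w = w"
proof -
  have "f = (\<lambda>x\<in>pts X. x)"
    by (rule extensionalityI[where A = "pts X"])
      (use slice_hom_PiE[OF f(1)] in \<open>auto simp: f(2) PiE_def\<close>)
  then show ?thesis
    using Tmap_id[OF slice_ob_small[OF X]] w by (simp add: T_map_def pts_T)
qed

lemma T_map_slice_hom:
  assumes X: "slice_ob Q X" and Y: "slice_ob Q Y" and f: "f \<in> slice_hom X Y"
  shows "T_map M X Y f \<in> slice_hom (T X) (T Y)"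
proof -
  have "T_map M X Y f \<in> pts (T X) \<rightarrow>\<^sub>E pts (T Y)"
    using Tmap_closed[OF slice_ob_small[OF X] slice_ob_small[OF Y] slice_hom_PiE[OF f]]
    by (simp add: T_map_def pts_T)
  moreover have "arr (T Y) (T_map M X Y f w) = arr (T X) w" if w: "w \<in> pts (T X)" for w
    unfolding arr_T[OF w] arr_T[OF T_map_mem[OF X Y f w]]
    using T_map_compose[OF X Y slice_B f arr_slice_hom[OF Y] arr_slice_hom[OF X] _ w]
      slice_hom_arr[OF f] by simp
  ultimately show ?thesis
    by (simp add: slice_hom_def)
qed

lemma arr_T_B: "w \<in> Tob M (Ob Q) \<Longrightarrow> arr (T B) w = \<zeta> w"
  using T_map_id[OF slice_B arr_slice_hom[OF slice_B], of w] arr_T[of w B]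
  by (simp add: pts_T)

lemma zeta_slice_hom: "\<zeta> \<in> slice_hom (T B) B"
  using zeta_closed PiE_mem[OF zeta_closed] by (simp add: slice_hom_def pts_T arr_T_B)

lemma ret_natural_at:
  assumes "slice_ob Q X" "slice_ob Q Y" "f \<in> slice_hom X Y" "x \<in> pts X"
  shows "T_map M X Y f (ret M (pts X) x) = ret M (pts Y) (f x)"
  using fun_cong[OF ret_natural[OF slice_ob_small[OF assms(1)] slice_ob_small[OF assms(2)]
        slice_hom_PiE[OF assms(3)]], of x] assms(4)
  by (simp add: T_map_def compose_eq)

lemma mul_natural_at:
  assumes "slice_ob Q X" "slice_ob Q Y" "f \<in> slice_hom X Y" "w \<in> pts (T (T X))"
  shows "T_map M X Y f (mul M (pts X) w) = mul M (pts Y) (T_map M (T X) (T Y) (T_map M X Y f) w)"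
  using fun_cong[OF mul_natural[OF slice_ob_small[OF assms(1)] slice_ob_small[OF assms(2)]
        slice_hom_PiE[OF assms(3)]], of w] assms(4)
  by (simp add: T_map_def pts_T compose_eq)

text \<open>
  That the unit and the multiplication of the monad preserve arrays is what the two laws of an
  algebra say of \<open>\<zeta>\<close>.
\<close>

lemma ret_slice_hom:
  assumes X: "slice_ob Q X"
  shows "ret M (pts X) \<in> slice_hom X (T X)"
proof -
  have ret: "ret M (pts X) \<in> pts X \<rightarrow>\<^sub>E pts (T X)"
    using ret_closed[OF slice_ob_small[OF X]] by (simp add: pts_T)
  moreover have "arr (T X) (ret M (pts X) x) = arr X x" if x: "x \<in> pts X" for x
    using arr_T[OF PiE_mem[OF ret x]] ret_natural_at[OF X slice_B arr_slice_hom[OF X] x]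
      zeta_ret[OF slice_ob_arr[OF X x]] by simp
  ultimately show ?thesis
    by (simp add: slice_hom_def)
qed

lemma mul_slice_hom:
  assumes X: "slice_ob Q X"
  shows "mul M (pts X) \<in> slice_hom (T (T X)) (T X)"
proof -
  note TX = slice_T[OF X] and TB = slice_T[OF slice_B] and a = arr_slice_hom[OF X]
  note Ta = T_map_slice_hom[OF X slice_B a]
  have mul: "mul M (pts X) \<in> pts (T (T X)) \<rightarrow>\<^sub>E pts (T X)"
    using mul_closed[OF slice_ob_small[OF X]] by (simp add: pts_T)
  moreover have "arr (T X) (mul M (pts X) w) = arr (T (T X)) w" if w: "w \<in> pts (T (T X))" for w
  proof -
    let ?v = "T_map M (T X) (T B) (T_map M X B (arr X)) w"
    have v: "?v \<in> Tob M (Tob M (Ob Q))"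
      using T_map_mem[OF TX TB Ta w] by (simp add: pts_T)
    have "arr (T X) (mul M (pts X) w) = \<zeta> (mul M (Ob Q) ?v)"
      using arr_T[OF PiE_mem[OF mul w]] mul_natural_at[OF X slice_B a w] by simp
    also have "\<dots> = \<zeta> (T_map M (T B) B \<zeta> ?v)"
      using zeta_mul[OF v] by (simp add: T_map_def pts_T)
    also have "T_map M (T B) B \<zeta> ?v = T_map M (T X) B (arr (T X)) w"
      using T_map_compose[OF TX TB slice_B Ta zeta_slice_hom arr_slice_hom[OF TX] arr_T w] by simp
    also have "\<zeta> \<dots> = arr (T (T X)) w"
      using arr_T[OF w] by simp
    finally show ?thesis .
  qed
  ultimately show ?thesis
    by (simp add: slice_hom_def)
qed

end


section \<open>The law of a topological theory\<close>

locale topological_theory_on_slice = slice_monad Q M \<zeta>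
  for Q :: "'u::set_universe quantaloid" and M :: "'u set_monad" and \<zeta> :: "'u \<Rightarrow> 'u" +
  fixes \<xi> :: "'u \<Rightarrow> 'u"
  assumes top_theory: "topological_theory Q M \<zeta> \<xi>"
begin

lemma slice_PB: "slice_ob Q (P B)"
  by (rule slice_ob_P[OF slice_B])

lemma slice_TPB: "slice_ob Q (T (P B))"
  by (rule slice_T[OF slice_PB])

lemma xi_slice_hom: "\<xi> \<in> slice_hom (T (P B)) (P B)"
proof -
  have \<xi>: "\<xi> \<in> pts (T (P B)) \<rightarrow>\<^sub>E pts (P B)"
    and comp: "compose (pts (T (P B))) (arr (P B)) \<xi>
      = compose (pts (T (P B))) \<zeta> (Tmap M (pts (P B)) (Ob Q) (arr (P B)))"
    using top_theory unfolding topological_theory_def Let_def by blast+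
  have "arr (P B) (\<xi> w) = arr (T (P B)) w" if w: "w \<in> pts (T (P B))" for w
    using fun_cong[OF comp, of w] w arr_T[OF w] by (simp only: compose_eq T_map_def pts_base)
  with \<xi> show ?thesis
    by (simp add: slice_hom_def)
qed

lemma xi_unit: "p \<in> psh_set Q B \<Longrightarrow> psh_le Q B p (\<xi> (ret M (psh_set Q B) p))"
  using top_theory by (simp add: topological_theory_def Let_def ptwise_le_def compose_eq)

lemma xi_mul: "w \<in> pts (T (T (P B))) \<Longrightarrow>
    psh_le Q B (\<xi> (T_map M (T (P B)) (P B) \<xi> w)) (\<xi> (mul M (psh_set Q B) w))"
  using top_theory by (simp add: topological_theory_def Let_def ptwise_le_def compose_eq)

lemma xi_yon: "w \<in> pts (T B) \<Longrightarrow> psh_le Q B (yon Q B (\<zeta> w)) (\<xi> (T_map M B (P B) (yon Q B) w))"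
  using top_theory by (simp add: topological_theory_def Let_def ptwise_le_def compose_eq)

lemma xi_psup: "w \<in> pts (T (P (P B))) \<Longrightarrow>
    psh_le Q B
      (psup Q B (push Q (T (P B)) (P B) \<xi> (pull Q (T (P B)) B (arr (T (P B)))
        (\<xi> (T_map M (P (P B)) (P B) (push Q (P B) B (arr (P B))) w)))))
      (\<xi> (T_map M (P (P B)) (P B) (psup Q B) w))"
  using top_theory
  by (simp add: topological_theory_def Let_def ptwise_le_def compose_eq theta_def)

lemma xi_mono:
  assumes "slice_ob Q Y" "f \<in> slice_hom Y (P B)" "g \<in> slice_hom Y (P B)"
    and "\<And>y. y \<in> pts Y \<Longrightarrow> psh_le Q B (f y) (g y)" and "w \<in> pts (T Y)"
  shows "psh_le Q B (\<xi> (T_map M Y (P B) f w)) (\<xi> (T_map M Y (P B) g w))"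
proof -
  have "\<forall>Y f g. slice_ob Q Y \<and> f \<in> slice_hom Y (P B) \<and> g \<in> slice_hom Y (P B) \<and>
          ptwise_le Q (pts Y) B f g \<longrightarrow>
        ptwise_le Q (pts (T Y)) B
          (compose (pts (T Y)) \<xi> (T_map M Y (P B) f))
          (compose (pts (T Y)) \<xi> (T_map M Y (P B) g))"
    using top_theory unfolding topological_theory_def Let_def by blast
  from this[rule_format, of Y f g] show ?thesis
    using assms by (simp add: ptwise_le_def compose_eq)
qed

text \<open>The part \<open>c\<^sub>X = \<xi> \<cdot> T(a\<^sub>!)\<close> of the law that takes place over the objects of the quantaloid.\<close>

definition theory_at :: "'u slice \<Rightarrow> 'u \<Rightarrow> 'u" where
  "theory_at X = compose (pts (T (P X))) \<xi> (T_map M (P X) (P B) (push Q X B (arr X)))"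

lemma theory_at_eq: "w \<in> pts (T (P X)) \<Longrightarrow>
    theory_at X w = \<xi> (T_map M (P X) (P B) (push Q X B (arr X)) w)"
  by (simp add: theory_at_def compose_eq)

lemma push_arr_slice_hom:
  "slice_ob Q X \<Longrightarrow> push Q X B (arr X) \<in> slice_hom (P X) (P B)"
  by (rule push_slice_hom[OF _ slice_B arr_slice_hom])

lemma theory_at_slice_hom:
  assumes X: "slice_ob Q X"
  shows "theory_at X \<in> slice_hom (T (P X)) (P B)"
  unfolding theory_at_def
  by (rule slice_hom_compose[OF T_map_slice_hom[OF slice_ob_P[OF X] slice_PB
          push_arr_slice_hom[OF X]] xi_slice_hom])

lemma theory_at_psh: "slice_ob Q X \<Longrightarrow> w \<in> pts (T (P X)) \<Longrightarrow> theory_at X w \<in> psh_set Q B"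
  using slice_hom_mem[OF theory_at_slice_hom] by simp

lemma theory_at_T_map:
  assumes X: "slice_ob Q X" and Y: "slice_ob Q Y" and g: "g \<in> slice_hom Y (P X)"
    and h: "h \<in> slice_hom Y (P B)" "\<And>y. y \<in> pts Y \<Longrightarrow> h y = push Q X B (arr X) (g y)"
    and w: "w \<in> pts (T Y)"
  shows "theory_at X (T_map M Y (P X) g w) = \<xi> (T_map M Y (P B) h w)"
  using T_map_compose[OF Y slice_ob_P[OF X] slice_PB g push_arr_slice_hom[OF X] h w]
    theory_at_eq[OF T_map_mem[OF Y slice_ob_P[OF X] g w]] by simp

text \<open>Array-preserving maps leave the direct image along the array map unchanged.\<close>

lemma theory_at_natural:
  assumes X: "slice_ob Q X" and Y: "slice_ob Q Y" and f: "f \<in> slice_hom X Y"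
    and w: "w \<in> pts (T (P X))"
  shows "theory_at Y (T_map M (P X) (P Y) (push Q X Y f) w) = theory_at X w"
  using theory_at_T_map[OF Y slice_ob_P[OF X] push_slice_hom[OF X Y f] push_arr_slice_hom[OF X] _ w]
    push_compose[OF X Y slice_B f arr_slice_hom[OF Y] arr_slice_hom[OF X]]
    slice_hom_arr[OF f] theory_at_eq[OF w] by simp

abbreviation law :: "'u slice \<Rightarrow> 'u \<Rightarrow> 'u" where "law \<equiv> law_of_theory Q M \<zeta> \<xi>"

lemma law_eq: "w \<in> pts (T (P X)) \<Longrightarrow> law X w = pull Q (T X) B (arr (T X)) (theory_at X w)"
  by (simp add: law_of_theory_def Let_def theory_at_def compose_eq)

lemma law_slice_hom:
  assumes X: "slice_ob Q X"
  shows "law X \<in> slice_hom (T (P X)) (P (T X))"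
proof -
  have "law X = compose (pts (T (P X))) (pull Q (T X) B (arr (T X))) (theory_at X)"
    by (simp add: law_of_theory_def Let_def theory_at_def)
  then show ?thesis
    using slice_hom_compose[OF theory_at_slice_hom[OF X]
        pull_slice_hom[OF slice_T[OF X] slice_B arr_slice_hom[OF slice_T[OF X]]]] by simp
qed

lemma law_psh: "slice_ob Q X \<Longrightarrow> w \<in> pts (T (P X)) \<Longrightarrow> law X w \<in> psh_set Q (T X)"
  using slice_hom_mem[OF law_slice_hom] by simp

text \<open>
  The law is an inverse image along the array map of \<open>TX\<close>, so presheaves below it are transposed to
  presheaves on the objects.
\<close>

lemma le_law_iff:
  assumes X: "slice_ob Q X" and w: "w \<in> pts (T (P X))" and p: "p \<in> psh_set Q (T X)"
  shows "psh_le Q (T X) p (law X w) \<longleftrightarrow> psh_le Q B (push Q (T X) B (arr (T X)) p) (theory_at X w)"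
  using push_pull_adjoint[OF slice_T[OF X] slice_B arr_slice_hom[OF slice_T[OF X]] p
      theory_at_psh[OF X w]] law_eq[OF w] by simp

lemma push_law_le:
  assumes X: "slice_ob Q X" and w: "w \<in> pts (T (P X))"
  shows "psh_le Q B (push Q (T X) B (arr (T X)) (law X w)) (theory_at X w)"
  using le_law_iff[OF X w law_psh[OF X w]] psh_le_refl[OF slice_T[OF X] law_psh[OF X w]] by simp

text \<open>
  As \<open>Tf\<close> preserves arrays, transposing removes \<open>f\<close> from both sides and leaves \<open>\<alpha>\<^sub>! \<cdot> \<alpha>\<^sup>! \<le> 1\<close> at the
  presheaf \<open>c\<^sub>X w\<close>.
\<close>

lemma law_natural:
  assumes X: "slice_ob Q X" and Y: "slice_ob Q Y" and f: "f \<in> slice_hom X Y"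
    and w: "w \<in> pts (T (P X))"
  shows "psh_le Q (T Y) (push Q (T X) (T Y) (T_map M X Y f) (law X w))
    (law Y (T_map M (P X) (P Y) (push Q X Y f) w))"
proof -
  note TX = slice_T[OF X] and TY = slice_T[OF Y] and Tf = T_map_slice_hom[OF X Y f]
  note w' = T_map_mem[OF slice_ob_P[OF X] slice_ob_P[OF Y] push_slice_hom[OF X Y f] w]
  have "push Q (T Y) B (arr (T Y)) (push Q (T X) (T Y) (T_map M X Y f) (law X w))
      = push Q (T X) B (arr (T X)) (law X w)"
    using push_compose[OF TX TY slice_B Tf arr_slice_hom[OF TY] arr_slice_hom[OF TX] _
        law_psh[OF X w]] slice_hom_arr[OF Tf] by simp
  then show ?thesis
    using le_law_iff[OF Y w' push_psh[OF TX TY Tf law_psh[OF X w]]] push_law_le[OF X w]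
      theory_at_natural[OF X Y f w] by simp
qed

lemma law_yon:
  assumes X: "slice_ob Q X" and w: "w \<in> pts (T X)"
  shows "psh_le Q (T X) (yon Q (T X) w) (law X (T_map M X (P X) (yon Q X) w))"
proof -
  note TX = slice_T[OF X] and PX = slice_ob_P[OF X] and a = arr_slice_hom[OF X]
  note yB = yon_slice_hom[OF slice_B]
  let ?h = "compose (pts X) (yon Q B) (arr X)"
  have h: "?h \<in> slice_hom X (P B)"
    by (rule slice_hom_compose[OF a yB])
  have "theory_at X (T_map M X (P X) (yon Q X) w) = \<xi> (T_map M X (P B) ?h w)"
    by (rule theory_at_T_map[OF X X yon_slice_hom[OF X] h _ w])
      (simp add: compose_eq yon_natural[OF X slice_B a])
  also have "\<dots> = \<xi> (T_map M B (P B) (yon Q B) (T_map M X B (arr X) w))"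
    using T_map_compose[OF X slice_B slice_PB a yB h _ w] by (simp add: compose_eq)
  finally have "psh_le Q B (yon Q B (arr (T X) w)) (theory_at X (T_map M X (P X) (yon Q X) w))"
    using xi_yon[OF T_map_mem[OF X slice_B a w]] arr_T[OF w] by simp
  then show ?thesis
    using le_law_iff[OF X T_map_mem[OF X PX yon_slice_hom[OF X] w] yon_psh[OF TX w]]
      yon_natural[OF TX slice_B arr_slice_hom[OF TX] w] by simp
qed

text \<open>
  Let \<open>U = c\<^sub>P\<^sub>X w\<close>. Both the left side and the left side of the axiom for \<open>\<xi>\<close> are Kleisli extensions
  applied to inverse images of \<open>U\<close>. The composite with index \<open>S \<in> TPX\<close> of the former is the
  composite with index \<open>T(a\<^sub>!) S\<close> of the latter, since \<open>T(a\<^sub>!)\<close> preserves arrays and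
  \<open>c\<^sub>X S = \<xi> (T(a\<^sub>!) S)\<close>.
\<close>

lemma law_psup:
  assumes X: "slice_ob Q X" and w: "w \<in> pts (T (P (P X)))"
  shows "psh_le Q (T X) (psup Q (T X) (push Q (T (P X)) (P (T X)) (law X) (law (P X) w)))
    (law X (T_map M (P (P X)) (P X) (psup Q X) w))"
proof -
  note PX = slice_ob_P[OF X] and TX = slice_T[OF X] and a = arr_slice_hom[OF X]
  note PPX = slice_ob_P[OF PX] and TPX = slice_T[OF PX] and PPB = slice_ob_P[OF slice_PB]
  note a1 = push_arr_slice_hom[OF X]
  note a2 = push_slice_hom[OF PX slice_PB a1]
  note sX = psup_slice_hom[OF X] and sB = psup_slice_hom[OF slice_B]
  note U = theory_at_psh[OF PX w]
  let ?U = "theory_at (P X) w"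
  let ?w = "T_map M (P (P X)) (P (P B)) (push Q (P X) (P B) (push Q X B (arr X))) w"
  let ?R = "theory_at X (T_map M (P (P X)) (P X) (psup Q X) w)"
  note sw = T_map_mem[OF PPX PX sX w]
  note R = theory_at_psh[OF X sw]
  note w' = T_map_mem[OF PPX PPB a2 w]
  let ?h = "compose (pts (P (P X))) (psup Q B) (push Q (P X) (P B) (push Q X B (arr X)))"
  have h: "?h \<in> slice_hom (P (P X)) (P B)"
    by (rule slice_hom_compose[OF a2 sB])
  \<comment> \<open>naturality of \<open>psup\<close> carries the right side to the right side of the axiom for \<open>\<xi>\<close> at \<open>T(a\<^sub>!\<^sub>!) w\<close>\<close>
  have "?R = \<xi> (T_map M (P (P X)) (P B) ?h w)"
    by (rule theory_at_T_map[OF X PPX sX h _ w])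
      (simp add: compose_eq psup_natural[OF X slice_B a])
  also have "\<dots> = \<xi> (T_map M (P (P B)) (P B) (psup Q B) ?w)"
    using T_map_compose[OF PPX PPB slice_PB a2 sB h _ w] by (simp add: compose_eq)
  finally have R_eq: "?R = \<xi> (T_map M (P (P B)) (P B) (psup Q B) ?w)" .
  \<comment> \<open>the presheaf that the axiom for \<open>\<xi>\<close> pulls back is \<open>U\<close>, as \<open>a\<^sub>!\<close> preserves arrays\<close>
  have U_eq: "\<xi> (T_map M (P (P B)) (P B) (push Q (P B) B (arr (P B))) ?w) = ?U"
    using theory_at_natural[OF PX slice_PB a1 w] theory_at_eq[OF w'] by simp
  let ?VB = "pull Q (T (P B)) B (arr (T (P B))) ?U"
  note tB = arr_slice_hom[OF slice_TPB]
  note VB = pull_psh[OF slice_TPB slice_B tB U] and cVB = fcod_pull[OF slice_TPB slice_B tB U]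
  have "psh_le Q B (psup Q B (push Q (T (P B)) (P B) \<xi> ?VB)) ?R \<longleftrightarrow>
      fcod ?U = fcod ?R \<and> (\<forall>S\<in>pts (T (P B)). \<forall>q\<in>Ob Q.
        Comp Q q (arr (T (P B)) S) (fcod ?U) (fcomp ?U (arr (T (P B)) S)) (fcomp (\<xi> S) q)
          \<sqsubseteq>\<^bsub>Hom Q q (fcod ?U)\<^esub> fcomp ?R q)"
    using psup_push_le_iff[OF slice_B slice_TPB xi_slice_hom VB R]
    by (simp add: cVB fcomp_pull[OF slice_TPB slice_B tB U] cong: ball_cong)
  moreover have "psh_le Q B (psup Q B (push Q (T (P B)) (P B) \<xi> ?VB)) ?R"
    using xi_psup[OF w'] unfolding R_eq U_eq .
  ultimately have cod: "fcod ?U = fcod ?R"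
    and base_le: "\<And>S q. S \<in> pts (T (P B)) \<Longrightarrow> q \<in> Ob Q \<Longrightarrow>
      Comp Q q (arr (T (P B)) S) (fcod ?U) (fcomp ?U (arr (T (P B)) S)) (fcomp (\<xi> S) q)
        \<sqsubseteq>\<^bsub>Hom Q q (fcod ?U)\<^esub> fcomp ?R q"
    by blast+
  note t = arr_slice_hom[OF TPX] and \<alpha> = arr_slice_hom[OF TX]
  have V_eq: "law (P X) w = pull Q (T (P X)) B (arr (T (P X))) ?U"
    by (rule law_eq[OF w])
  have "Comp Q (arr (T X) v) (arr (T (P X)) S) (fcod (law (P X) w)) (fcomp (law (P X) w) S)
      (fcomp (law X S) v)
    \<sqsubseteq>\<^bsub>Hom Q (arr (T X) v) (fcod (law (P X) w))\<^esub>
      fcomp (law X (T_map M (P (P X)) (P X) (psup Q X) w)) v"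
    if S: "S \<in> pts (T (P X))" and v: "v \<in> pts (T X)" for S v
  proof -
    note S' = T_map_mem[OF PX slice_PB a1 S]
    have "arr (T (P B)) (T_map M (P X) (P B) (push Q X B (arr X)) S) = arr (T (P X)) S"
      by (rule slice_hom_arr[OF T_map_slice_hom[OF PX slice_PB a1] S])
    with base_le[OF S' slice_ob_arr[OF TX v]] show ?thesis
      by (simp add: V_eq fcod_pull[OF TPX slice_B t U] fcomp_pull[OF TPX slice_B t U S]
          law_eq[OF S] law_eq[OF sw] fcomp_pull[OF TX slice_B \<alpha> theory_at_psh[OF X S] v]
          fcomp_pull[OF TX slice_B \<alpha> R v] theory_at_eq[OF S, symmetric])
  qed
  moreover have "fcod (law (P X) w) = fcod (law X (T_map M (P (P X)) (P X) (psup Q X) w))"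
    using cod by (simp add: V_eq fcod_pull[OF TPX slice_B t U] law_eq[OF sw]
        fcod_pull[OF TX slice_B \<alpha> R])
  ultimately show ?thesis
    using psup_push_le_iff[OF TX TPX law_slice_hom[OF X] law_psh[OF PX w] law_psh[OF X sw]] by blast
qed

lemma law_ret:
  assumes X: "slice_ob Q X" and p: "p \<in> psh_set Q X"
  shows "psh_le Q (T X) (push Q X (T X) (ret M (pts X)) p) (law X (ret M (psh_set Q X) p))"
proof -
  note TX = slice_T[OF X] and PX = slice_ob_P[OF X] and a = arr_slice_hom[OF X]
  note e = ret_slice_hom[OF X]
  have rp: "ret M (psh_set Q X) p \<in> pts (T (P X))"
    using slice_hom_mem[OF ret_slice_hom[OF PX], of p] p by simp
  have "theory_at X (ret M (psh_set Q X) p) = \<xi> (ret M (psh_set Q B) (push Q X B (arr X) p))"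
    using theory_at_eq[OF rp] ret_natural_at[OF PX slice_PB push_arr_slice_hom[OF X], of p] p by simp
  moreover have "push Q (T X) B (arr (T X)) (push Q X (T X) (ret M (pts X)) p) = push Q X B (arr X) p"
    using push_compose[OF X TX slice_B e arr_slice_hom[OF TX] a _ p] slice_hom_arr[OF e] by simp
  ultimately show ?thesis
    using le_law_iff[OF X rp push_psh[OF X TX e p]] xi_unit[OF push_psh[OF X slice_B a p]] by simp
qed

text \<open>
  With \<open>\<alpha>\<close> the array map of \<open>TX\<close>, the chain is
  \<open>c\<^sub>T\<^sub>X \<cdot> T\<lambda>\<^sub>X = \<xi> \<cdot> T(\<alpha>\<^sub>! \<cdot> \<lambda>\<^sub>X) \<le> \<xi> \<cdot> Tc\<^sub>X = \<xi> \<cdot> T\<xi> \<cdot> TT(a\<^sub>!) \<le> \<xi> \<cdot> m \<cdot> TT(a\<^sub>!) = c\<^sub>X \<cdot> m\<close>.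
\<close>

lemma law_mul:
  assumes X: "slice_ob Q X" and w: "w \<in> pts (T (T (P X)))"
  shows "psh_le Q (T X)
    (push Q (T (T X)) (T X) (mul M (pts X)) (law (T X) (T_map M (T (P X)) (P (T X)) (law X) w)))
    (law X (mul M (psh_set Q X) w))"
proof -
  note PX = slice_ob_P[OF X] and TX = slice_T[OF X] and a1 = push_arr_slice_hom[OF X]
  note TPX = slice_T[OF PX] and TTX = slice_T[OF TX] and PTX = slice_ob_P[OF TX]
  note m = mul_slice_hom[OF X] and l = law_slice_hom[OF X]
  note Ta1 = T_map_slice_hom[OF PX slice_PB a1]
  let ?v = "T_map M (T (P X)) (P (T X)) (law X) w"
  note v = T_map_mem[OF TPX PTX l w]
  have mw: "mul M (psh_set Q X) w \<in> pts (T (P X))"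
    using slice_hom_mem[OF mul_slice_hom[OF PX] w] by simp
  let ?h = "compose (pts (T (P X))) (push Q (T X) B (arr (T X))) (law X)"
  have h: "?h \<in> slice_hom (T (P X)) (P B)"
    by (rule slice_hom_compose[OF l push_arr_slice_hom[OF TX]])
  note th = theory_at_slice_hom[OF X]
  note w' = T_map_mem[OF TPX slice_TPB Ta1 w]
  have "theory_at (T X) ?v = \<xi> (T_map M (T (P X)) (P B) ?h w)"
    by (rule theory_at_T_map[OF TX TPX l h _ w]) (simp add: compose_eq)
  then have 1: "psh_le Q B (theory_at (T X) ?v) (\<xi> (T_map M (T (P X)) (P B) (theory_at X) w))"
    using xi_mono[OF TPX h th _ w] push_law_le[OF X] by (simp add: compose_eq)
  have "T_map M (T (P X)) (P B) (theory_at X) w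
      = T_map M (T (P B)) (P B) \<xi> (T_map M (T (P X)) (T (P B)) (T_map M (P X) (P B) (push Q X B (arr X))) w)"
    by (rule T_map_compose[OF TPX slice_TPB slice_PB Ta1 xi_slice_hom th theory_at_eq w])
  moreover have "theory_at X (mul M (psh_set Q X) w) = \<xi> (mul M (psh_set Q B)
      (T_map M (T (P X)) (T (P B)) (T_map M (P X) (P B) (push Q X B (arr X))) w))"
    using theory_at_eq[OF mw] mul_natural_at[OF PX slice_PB a1 w] by simp
  ultimately have 2: "psh_le Q B (\<xi> (T_map M (T (P X)) (P B) (theory_at X) w))
      (theory_at X (mul M (psh_set Q X) w))"
    using xi_mul[OF w'] by simp
  have "\<xi> (T_map M (T (P X)) (P B) (theory_at X) w) \<in> psh_set Q B"
    using slice_hom_mem[OF xi_slice_hom T_map_mem[OF TPX slice_PB th w]] by simp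
  note theory_le = psh_le_trans[OF slice_B theory_at_psh[OF TX v] this theory_at_psh[OF X mw] 1 2]
  have "push Q (T X) B (arr (T X)) (push Q (T (T X)) (T X) (mul M (pts X)) (law (T X) ?v))
      = push Q (T (T X)) B (arr (T (T X))) (law (T X) ?v)"
    using push_compose[OF TTX TX slice_B m arr_slice_hom[OF TX] arr_slice_hom[OF TTX] _
        law_psh[OF TX v]] slice_hom_arr[OF m] by simp
  moreover have "psh_le Q B (push Q (T (T X)) B (arr (T (T X))) (law (T X) ?v))
      (theory_at X (mul M (psh_set Q X) w))"
    using psh_le_trans[OF slice_B push_psh[OF TTX slice_B arr_slice_hom[OF TTX] law_psh[OF TX v]]
        theory_at_psh[OF TX v] theory_at_psh[OF X mw] push_law_le[OF TX v] theory_le] .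
  ultimately show ?thesis
    using le_law_iff[OF X mw push_psh[OF TTX TX m law_psh[OF TX v]]] by simp
qed

lemma law_mono:
  assumes X: "slice_ob Q X" and Y: "slice_ob Q Y"
    and f: "f \<in> slice_hom Y (P X)" and g: "g \<in> slice_hom Y (P X)"
    and le: "\<And>y. y \<in> pts Y \<Longrightarrow> psh_le Q X (f y) (g y)" and w: "w \<in> pts (T Y)"
  shows "psh_le Q (T X) (law X (T_map M Y (P X) f w)) (law X (T_map M Y (P X) g w))"
proof -
  note PX = slice_ob_P[OF X] and TX = slice_T[OF X] and a1 = push_arr_slice_hom[OF X]
  let ?h = "\<lambda>f. compose (pts Y) (push Q X B (arr X)) f"
  have h: "?h k \<in> slice_hom Y (P B)" if "k \<in> slice_hom Y (P X)" for k
    by (rule slice_hom_compose[OF that a1])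
  have eq: "theory_at X (T_map M Y (P X) k w) = \<xi> (T_map M Y (P B) (?h k) w)"
    if "k \<in> slice_hom Y (P X)" for k
    by (rule theory_at_T_map[OF X Y that h[OF that] _ w]) (simp add: compose_eq)
  have "psh_le Q B (?h f y) (?h g y)" if y: "y \<in> pts Y" for y
    using push_mono[OF X slice_B arr_slice_hom[OF X], of "f y" "g y"]
      slice_hom_mem[OF f y] slice_hom_mem[OF g y] le[OF y] y by (simp add: compose_eq)
  then have "psh_le Q B (theory_at X (T_map M Y (P X) f w)) (theory_at X (T_map M Y (P X) g w))"
    unfolding eq[OF f] eq[OF g] by (rule xi_mono[OF Y h[OF f] h[OF g] _ w])
  note le' = this
  note fw = T_map_mem[OF Y PX f w] and gw = T_map_mem[OF Y PX g w]
  show ?thesis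
    unfolding law_eq[OF fw] law_eq[OF gw]
    by (rule pull_mono[OF TX slice_B arr_slice_hom[OF TX] theory_at_psh[OF X fw]
          theory_at_psh[OF X gw] le'])
qed

lemma law_distributive: "monotone_distributive_law Q M \<zeta> law"
  unfolding monotone_distributive_law_def Let_def ptwise_le_def
  by (intro conjI allI impI ballI) (simp_all add: compose_eq law_slice_hom law_natural law_yon law_psup law_ret law_mul law_mono)

text \<open>The unit of the monad is a section of \<open>\<zeta>\<close>, so \<open>\<zeta>\<close> is surjective and \<open>\<zeta>\<^sub>! \<cdot> \<zeta>\<^sup>! = 1\<close>.\<close>

lemma law_induces: "induces Q M \<zeta> law \<xi>"
  unfolding induces_def Let_def
proof (rule extensionalityI)
  show "compose (pts (T (P B))) (push Q (T B) B \<zeta>) (law B) \<in> extensional (pts (T (P B)))"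
    by (rule compose_extensional)
  show "\<xi> \<in> extensional (pts (T (P B)))"
    using slice_hom_PiE[OF xi_slice_hom] by (simp add: PiE_def)
  fix w assume w: "w \<in> pts (T (P B))"
  note TB = slice_T[OF slice_B]
  have "push Q B B (arr B) p = p" if "p \<in> psh_set Q B" for p
    by (rule push_id[OF slice_B that arr_slice_hom[OF slice_B]]) simp
  then have th: "theory_at B w = \<xi> w"
    using theory_at_eq[OF w] T_map_id[OF slice_PB push_arr_slice_hom[OF slice_B] _ w] by simp
  have zeta: "arr (T B) = \<zeta>"
    by (rule extensionalityI[where A = "Tob M (Ob Q)"])
      (use slice_hom_PiE[OF zeta_slice_hom] slice_hom_PiE[OF arr_slice_hom[OF TB]] in
        \<open>auto simp: PiE_def pts_T arr_T_B\<close>)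
  have surj: "\<exists>v\<in>pts (T B). \<zeta> v = q" if "q \<in> pts B" for q
    using slice_hom_mem[OF ret_slice_hom[OF slice_B] that] zeta_ret that by auto
  have "push Q (T B) B \<zeta> (law B w) = push Q (T B) B \<zeta> (pull Q (T B) B \<zeta> (\<xi> w))"
    using law_eq[OF w] by (simp add: th zeta)
  also have "\<dots> = \<xi> w"
    using push_pull_surj[OF TB slice_B zeta_slice_hom _ surj] slice_hom_mem[OF xi_slice_hom w] by simp
  finally show "compose (pts (T (P B))) (push Q (T B) B \<zeta>) (law B) w = \<xi> w"
    using w by (simp add: compose_eq)
qed

text \<open>
  Lax naturality of \<open>\<kappa>\<close> along the array map \<open>X \<rightarrow> B\<close> reduces the claim to the component at \<open>B\<close>, which
  becomes \<open>\<xi>\<close> after applying \<open>\<zeta>\<^sub>!\<close>.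
\<close>

lemma law_largest:
  assumes \<kappa>: "monotone_distributive_law Q M \<zeta> \<kappa>" and ind: "induces Q M \<zeta> \<kappa> \<xi>"
    and X: "slice_ob Q X" and w: "w \<in> pts (T (P X))"
  shows "psh_le Q (T X) (\<kappa> X w) (law X w)"
proof -
  note TX = slice_T[OF X] and TB = slice_T[OF slice_B] and PX = slice_ob_P[OF X]
  note a = arr_slice_hom[OF X] and a1 = push_arr_slice_hom[OF X]
  note Ta = T_map_slice_hom[OF X slice_B a]
  let ?w = "T_map M (P X) (P B) (push Q X B (arr X)) w"
  note w' = T_map_mem[OF PX slice_PB a1 w]
  have hom: "\<kappa> Y \<in> slice_hom (T (P Y)) (P (T Y))" if "slice_ob Q Y" for Y
    using \<kappa> that by (simp add: monotone_distributive_law_def Let_def)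
  have p: "\<kappa> X w \<in> psh_set Q (T X)" and p': "\<kappa> B ?w \<in> psh_set Q (T B)"
    using slice_hom_mem[OF hom[OF X] w] slice_hom_mem[OF hom[OF slice_B] w'] by simp_all
  have "\<forall>X Y f. slice_ob Q X \<and> slice_ob Q Y \<and> f \<in> slice_hom X Y \<longrightarrow>
        ptwise_le Q (pts (T (P X))) (T Y)
          (compose (pts (T (P X))) (push Q (T X) (T Y) (T_map M X Y f)) (\<kappa> X))
          (compose (pts (T (P X))) (\<kappa> Y) (T_map M (P X) (P Y) (push Q X Y f)))"
    using \<kappa> unfolding monotone_distributive_law_def Let_def by blast
  from this[rule_format, of X B "arr X"]
  have nat: "psh_le Q (T B) (push Q (T X) (T B) (T_map M X B (arr X)) (\<kappa> X w)) (\<kappa> B ?w)"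
    using X slice_B a w by (simp add: ptwise_le_def compose_eq)
  have "push Q (T B) B \<zeta> (\<kappa> B ?w) = theory_at X w"
    using fun_cong[OF ind[unfolded induces_def Let_def], of ?w] w' theory_at_eq[OF w]
    by (simp add: compose_eq)
  moreover have "push Q (T X) B (arr (T X)) (\<kappa> X w)
      = push Q (T B) B \<zeta> (push Q (T X) (T B) (T_map M X B (arr X)) (\<kappa> X w))"
    by (rule push_compose[OF TX TB slice_B Ta zeta_slice_hom arr_slice_hom[OF TX] arr_T p])
  ultimately show ?thesis
    using le_law_iff[OF X w p]
      push_mono[OF TB slice_B zeta_slice_hom push_psh[OF TX TB Ta p] p' nat] by simp
qed

end

theorem theorem5p5:
  fixes Q :: "'u::set_universe quantaloid"
    and M :: "'u set_monad"
    and \<zeta> \<xi> :: "'u \<Rightarrow> 'u"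
  assumes "small_quantaloid Q"
    and "monad_on_Set M"
    and "em_algebra M (Ob Q) \<zeta>"
    and "topological_theory Q M \<zeta> \<xi>"
  shows "monotone_distributive_law Q M \<zeta> (law_of_theory Q M \<zeta> \<xi>)
    \<and> induces Q M \<zeta> (law_of_theory Q M \<zeta> \<xi>) \<xi>
    \<and> (\<forall>\<kappa>. monotone_distributive_law Q M \<zeta> \<kappa> \<and> induces Q M \<zeta> \<kappa> \<xi> \<longrightarrow>
          (\<forall>X. slice_ob Q X \<longrightarrow>
            ptwise_le Q (pts (T_ob Q M \<zeta> (P_ob Q X))) (T_ob Q M \<zeta> X)
              (\<kappa> X) (law_of_theory Q M \<zeta> \<xi> X)))"
proof -
  interpret topological_theory_on_slice Q M \<zeta> \<xi>
    using assms by (intro topological_theory_on_slice.intro slice_monad.intro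
        slice_monad_axioms.intro topological_theory_on_slice_axioms.intro)
  show ?thesis
    using law_distributive law_induces law_largest by (simp add: ptwise_le_def)
qed

end
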